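(* There exists a set $E\subseteq[0,1]$ with $\dim_{\mathbb F}E=1$ and the following property. For every $v\ge2$ and every $f\in\mathcal F_v(\mathbb N)$ there exists $\kappa>0$ such that whenever $(x_0,x_1,\ldots,x_v)\in E^{v+1}$ satisfies $$\operatorname{diam}(x_0,x_1,\ldots,x_v)<\kappa\quad\text{and}\quad f(x_0,x_1,\ldots,x_v)=0,$$ we have $x_0=x_1=\cdots=x_v$. In particular, a nontrivial zero $(x_0,\ldots,x_v)$ of $f$ in $E$, if it exists, obeys $\operatorname{diam}(x_0,\ldots,x_v)\ge\kappa$. In addition, the constant $\kappa=\kappa_N$ can be chosen uniformly for all $f\in\mathcal F$ whose coefficients are bounded by $N$.
   Context: $\mathbb N=\{1,2,\ldots\}$. For $v\ge2$, $\mathcal F_v(\mathbb N)$ is the set of functions $f(x_0,\ldots,x_v)=m_0x_0-\sum_{i=1}^v m_ix_i$ with $m_0,\ldots,m_v\in\mathbb N$, $m_0=\sum_{i=1}^v m_i$ and $\gcd(m_0,m_1,\ldots,m_v)=1$; $\mathcal F=\bigcup_{v=2}^\infty\mathcal F_v(\mathbb N)$. The coefficients of $f$ are $m_0,\ldots,m_v$. A nontrivial zero of $f$ in $E$ is a point of $E^{v+1}$ with all entries distinct at which $f$ vanishes. Also $\operatorname{diam}(x_0,\ldots,x_v)=\max\{|x_i-x_j|: i,j\in\{0,\ldots,v\},\ i\ne j\}$. The Fourier transform of a measure $\mu$ is $\widehat\mu(\xi)=\int e^{-ix\xi}\,d\mu(x)$. The Fourier dimension $\dim_{\mathbb F}(A)$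 of a Borel set $A\subseteq\mathbb R$ is the supremum of exponents $\beta\le 1$ for which there exist a probability measure $\mu$ supported on $A$ and a finite constant $C_2>0$ with $|\widehat\mu(\xi)|\le C_2(1+|\xi|)^{-\beta/2}$ for all $\xi\in\mathbb R$. *)

theory Defs
  imports "HOL-Probability.Probability"
begin

text \<open>A point of \<open>E\<close> to the power \<open>v + 1\<close> is a function \<open>x :: nat \<Rightarrow> real\<close> of which only the
  values \<open>x 0, \<dots>, x v\<close> are used; likewise for the coefficient vectors \<open>m\<close>.\<close>

definition lin_form :: "nat \<Rightarrow> (nat \<Rightarrow> nat) \<Rightarrow> (nat \<Rightarrow> real) \<Rightarrow> real" where
  "lin_form v m x = real (m 0) * x 0 - (\<Sum>i=1..v. real (m i) * x i)"

definition form_coeffs :: "nat \<Rightarrow> (nat \<Rightarrow> nat) set" where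
  "form_coeffs v = {m. (\<forall>i\<le>v. 1 \<le> m i) \<and> m 0 = (\<Sum>i=1..v. m i) \<and> Gcd (m ` {0..v}) = 1}"

definition forms :: "nat \<Rightarrow> ((nat \<Rightarrow> real) \<Rightarrow> real) set" where
  "forms v = lin_form v ` form_coeffs v"

definition in_power :: "real set \<Rightarrow> nat \<Rightarrow> (nat \<Rightarrow> real) \<Rightarrow> bool" where
  "in_power E v x \<longleftrightarrow> (\<forall>i\<le>v. x i \<in> E)"

definition tuple_diam :: "nat \<Rightarrow> (nat \<Rightarrow> real) \<Rightarrow> real" where
  "tuple_diam v x = Max {\<bar>x i - x j\<bar> | i j. i \<le> v \<and> j \<le> v \<and> i \<noteq> j}"

definition nontrivial_zero ::
  "real set \<Rightarrow> nat \<Rightarrow> ((nat \<Rightarrow> real) \<Rightarrow> real) \<Rightarrow> (nat \<Rightarrow> real) \<Rightarrow> bool" where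
  "nontrivial_zero E v f x \<longleftrightarrow> in_power E v x \<and> inj_on x {0..v} \<and> f x = 0"

text \<open>The sign is the opposite of that in the library's \<open>char\<close>.\<close>

definition fourier_transform :: "real measure \<Rightarrow> real \<Rightarrow> complex" where
  "fourier_transform \<mu> \<xi> = (CLINT x|\<mu>. iexp (- (x * \<xi>)))"

text \<open>Meant for Borel sets \<open>A\<close>; ``supported on \<open>A\<close>'' is read as \<open>measure \<mu> A = 1\<close>. Every \<open>\<beta> \<le> 0\<close>
  is admissible when \<open>A\<close> is nonempty. The supremum is taken in the extended reals only so that
  the dimension of the empty set is the definite value \<open>-\<infinity>\<close>.\<close>

definition fourier_dim :: "real set \<Rightarrow> ereal" where
  "fourier_dim A = Sup (ereal ` {\<beta>. \<beta> \<le> 1 \<and>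
     (\<exists>\<mu>. real_distribution \<mu> \<and> measure \<mu> A = 1 \<and>
        (\<exists>C>0. \<forall>\<xi>. cmod (fourier_transform \<mu> \<xi>) \<le> C * (1 + \<bar>\<xi>\<bar>) powr (- \<beta> / 2)))})"

end

theory Submission
  imports Defs "HOL-Real_Asymp.Real_Asymp"
begin

text \<open>\<open>E\<close> is a Cantor set whose digits at stage \<open>n\<close> come from a Behrend type set: points of a paraboloid
  written in a base so large that no carries occur. Strict convexity forbids nontrivial zeros of all
  forms with coefficients up to \<open>n + 1\<close>, and this survives translation modulo the base and the errors
  from later digits. The digit set below each cell is translated separately. For random translates the
  Fourier transforms of consecutive stages differ by a sum of independent centred terms, of size about
  the square root of their number; a greedy choice along an exponential moment achieves the same bound
  simultaneously at all frequencies of a fine net. Digit sets of nearly full logarithmic size then give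
  decay of every order below \<open>1 / 2\<close>.\<close>

text \<open>The translates reconcile two opposed demands. A convex digit set is rigid, and nothing
  makes its exponential sums small; yet the average over all its translates modulo the base is
  exactly the sum over all digits, so deviations from the uniform distribution become centred. For
  zeros a translation is harmless, since the coefficients of a form balance; only wrap-around must
  be excluded, and this makes the base larger than the range of the weighted digits. Stage
  \<open>n\<close> handles coefficients up to \<open>n + 1\<close> only. A form with coefficients up
  to \<open>N\<close> is therefore controlled from stage \<open>N\<close> on, once all points share
  a cell there. Hence \<kappa> is \<open>1 / L N\<close>, and zeros spread over larger distances are
  not excluded. The sizes \<open>c n\<close> and \<open>M n\<close> must meet a second demand: the
  error of stage \<open>n\<close>, about \<open>1 / sqrt (P n)\<close>, has to beat
  \<open>L (Suc n) powr (\<beta> / 2)\<close>, which already contains the next base. Exponents that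
  are cubes suffice: the binary logarithms of \<open>P n\<close> and \<open>L (Suc n)\<close> both
  grow like \<open>n ^ 4 / 4\<close> and differ by order \<open>n ^ 3\<close>.\<close>

section \<open>Convex digit sets\<close>

text \<open>Read \<open>r\<close> as the vector of its \<open>d\<close> lowest base \<open>D\<close> digits. The code lists this vector in
  base \<open>B\<close>, followed by its squared length added to the accumulator \<open>s\<close> as leading digit.\<close>

fun paraboloid_code :: "nat \<Rightarrow> nat \<Rightarrow> nat \<Rightarrow> nat \<Rightarrow> nat \<Rightarrow> nat" where
  "paraboloid_code B D 0 r s = s"
| "paraboloid_code B D (Suc d) r s =
     r mod D + B * paraboloid_code B D d (r div D) (s + (r mod D)\<^sup>2)"

text \<open>The variance identity about the weighted mean \<open>z\<close>: strict convexity of the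
  square in a form whose equality case can be read off.\<close>

lemma weighted_sum_sq_diff:
  fixes m x :: "'i \<Rightarrow> int"
  assumes "sum m I * z = (\<Sum>i\<in>I. m i * x i)"
  shows "(\<Sum>i\<in>I. m i * (x i)\<^sup>2) = sum m I * z\<^sup>2 + (\<Sum>i\<in>I. m i * (x i - z)\<^sup>2)"
proof -
  have "(\<Sum>i\<in>I. m i * (x i - z)\<^sup>2)
      = (\<Sum>i\<in>I. m i * (x i)\<^sup>2 - 2 * z * (m i * x i) + m i * z\<^sup>2)"
    by (intro sum.cong) (auto simp: power2_eq_square algebra_simps)
  also have "\<dots> = (\<Sum>i\<in>I. m i * (x i)\<^sup>2) - 2 * z * (sum m I * z) + sum m I * z\<^sup>2"
    unfolding assms by (simp add: sum.distrib sum_subtractf sum_distrib_left sum_distrib_right)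
  finally show ?thesis by (simp add: power2_eq_square)
qed

text \<open>Without carries the lowest digits satisfy the linear relation, so convexity preserves
  the inequality between accumulators when squares are added. After the last digit the codes are the
  accumulators themselves, which forces equality, and equality travels back through all digits. The
  hypothesis on \<open>s0\<close> exists for this induction; the application starts with zero
  accumulators.\<close>

lemma paraboloid_code_convex:
  fixes m r s :: "'i \<Rightarrow> nat"
  assumes "finite I" and pos: "\<And>i. i \<in> I \<Longrightarrow> 0 < m i" and "sum m I \<le> N" and D: "0 < D"
    and "sum m I * paraboloid_code (N * D) D d r0 s0
          = (\<Sum>i\<in>I. m i * paraboloid_code (N * D) D d (r i) (s i))"
    and "sum m I * s0 \<le> (\<Sum>i\<in>I. m i * s i)"
  shows "sum m I * s0 = (\<Sum>i\<in>I. m i * s i) \<and> (\<forall>i\<in>I. r i mod D ^ d = r0 mod D ^ d)"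
  using assms(5,6)
proof (induction d arbitrary: r0 s0 r s)
  case 0
  then show ?case by simp
next
  case (Suc d)
  define B where "B = N * D"
  define x where "x = (\<lambda>i. r i mod D)"
  define z where "z = r0 mod D"
  let ?c = "\<lambda>r s. paraboloid_code B D d (r div D) (s + (r mod D)\<^sup>2)"
  show ?case
  proof (cases "I = {}")
    case True
    then show ?thesis by simp
  next
    case False
    then have S0: "0 < sum m I"
      using pos assms(1) by (simp add: sum_pos)
    \<comment> \<open>The reason for the base \<open>N * D\<close>: total weight at most
      \<open>N\<close> times digits below \<open>D\<close> cannot carry, so reduction modulo
      \<open>B\<close> isolates the lowest digit.\<close>
    have small: "sum m I * y < B" if "y < D" for y
    proof -
      have "sum m I * y < sum m I * D" using that S0 by simp
      also have "\<dots> \<le> B" unfolding B_def using assms(3) by simp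
      finally show ?thesis .
    qed
    have eq: "sum m I * z + B * (sum m I * ?c r0 s0)
        = (\<Sum>i\<in>I. m i * x i) + B * (\<Sum>i\<in>I. m i * ?c (r i) (s i))"
      using Suc.prems(1)
      by (simp add: B_def x_def z_def sum.distrib sum_distrib_left algebra_simps)
    have a: "sum m I * z < B" using small D z_def by simp
    have "(\<Sum>i\<in>I. m i * x i) \<le> (\<Sum>i\<in>I. m i * (D - 1))"
      using D by (intro sum_mono mult_left_mono) (auto simp: x_def less_Suc_eq_le[symmetric])
    also have "\<dots> = sum m I * (D - 1)" by (simp add: sum_distrib_right)
    also have "\<dots> < B" using small[of "D - 1"] D by simp
    finally have b: "(\<Sum>i\<in>I. m i * x i) < B" .
    have lin: "sum m I * z = (\<Sum>i\<in>I. m i * x i)"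
      using arg_cong[OF eq, of "\<lambda>t. t mod B"] a b by simp
    then have eq': "sum m I * ?c r0 s0 = (\<Sum>i\<in>I. m i * ?c (r i) (s i))"
      using eq a by auto
    have sq: "(\<Sum>i\<in>I. int (m i) * (int (x i))\<^sup>2)
       = int (sum m I) * (int z)\<^sup>2 + (\<Sum>i\<in>I. int (m i) * (int (x i) - int z)\<^sup>2)"
      using weighted_sum_sq_diff[of "\<lambda>i. int (m i)" I "int z" "\<lambda>i. int (x i)"]
        arg_cong[OF lin, of int] by simp
    have nn: "0 \<le> (\<Sum>i\<in>I. int (m i) * (int (x i) - int z)\<^sup>2)"
      by (intro sum_nonneg) auto
    have "int (sum m I * z\<^sup>2) \<le> int (\<Sum>i\<in>I. m i * (x i)\<^sup>2)"
      using sq nn by simp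
    then have le: "sum m I * z\<^sup>2 \<le> (\<Sum>i\<in>I. m i * (x i)\<^sup>2)" by linarith
    have IH: "sum m I * (s0 + z\<^sup>2) = (\<Sum>i\<in>I. m i * (s i + (x i)\<^sup>2)) \<and>
        (\<forall>i\<in>I. (r i div D) mod D ^ d = (r0 div D) mod D ^ d)"
      unfolding x_def z_def
      by (rule Suc.IH) (use eq' le Suc.prems(2) in
        \<open>auto simp: B_def x_def z_def distrib_left sum.distrib\<close>)
    \<comment> \<open>Two inequalities add up to an equality, so each of them is an
      equality.\<close>
    then have e: "sum m I * s0 = (\<Sum>i\<in>I. m i * s i)" "sum m I * z\<^sup>2 = (\<Sum>i\<in>I. m i * (x i)\<^sup>2)"
      using le Suc.prems(2) by (auto simp: distrib_left sum.distrib)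
    have "(\<Sum>i\<in>I. int (m i) * (int (x i))\<^sup>2) = int (sum m I) * (int z)\<^sup>2"
      using arg_cong[OF e(2), of int] by simp
    then have "(\<Sum>i\<in>I. int (m i) * (int (x i) - int z)\<^sup>2) = 0"
      using sq by simp
    then have "\<forall>i\<in>I. int (m i) * (int (x i) - int z)\<^sup>2 = 0"
      using assms(1) by (subst (asm) sum_nonneg_eq_0_iff) auto
    then have "\<forall>i\<in>I. x i = z" using pos by fastforce
    then show ?thesis using IH e(1) by (auto simp: mod_mult2_eq x_def z_def)
  qed
qed

lemma paraboloid_code_less:
  assumes "0 < D" "0 < N"
  shows "paraboloid_code (N * D) D d r s < (N * D) ^ d * (s + d * D\<^sup>2 + 1)"
proof (induction d arbitrary: r s)
  case 0
  then show ?case by simp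
next
  case (Suc d)
  let ?B = "N * D" and ?x = "r mod D"
  have x: "?x < D" using assms by simp
  have "D \<le> ?B" using assms by simp
  then have xB: "?x < ?B" using x by linarith
  have "paraboloid_code ?B D d (r div D) (s + ?x\<^sup>2) + 1 \<le> ?B ^ d * (s + ?x\<^sup>2 + d * D\<^sup>2 + 1)"
    using Suc.IH[of "r div D" "s + ?x\<^sup>2"] by linarith
  also have "\<dots> \<le> ?B ^ d * (s + Suc d * D\<^sup>2 + 1)"
    using x by (intro mult_left_mono) (auto simp: power_mono)
  finally have "?B * (paraboloid_code ?B D d (r div D) (s + ?x\<^sup>2) + 1)
      \<le> ?B * (?B ^ d * (s + Suc d * D\<^sup>2 + 1))" by (rule mult_left_mono) simp
  then show ?case using xB by (simp add: distrib_left mult.assoc)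
qed

text \<open>\<open>convex_digits\<close> says that a translate mod \<open>M\<close> of the digit set admits only trivial
  solutions, even up to an error \<open>N\<close> caused by the lower order digits.\<close>

definition convex_digits :: "nat \<Rightarrow> nat \<Rightarrow> nat \<Rightarrow> (nat \<Rightarrow> nat) \<Rightarrow> bool" where
  "convex_digits N M c A \<longleftrightarrow>
    (\<forall>I m r r0 a. finite (I :: nat set) \<longrightarrow> (\<forall>i\<in>I. 0 < m i \<and> r i < c) \<longrightarrow> r0 < c \<longrightarrow>
      sum m I \<le> N \<longrightarrow>
      \<bar>int (sum m I) * int ((A r0 + a) mod M) - (\<Sum>i\<in>I. int (m i) * int ((A (r i) + a) mod M))\<bar>
        \<le> int N \<longrightarrow> (\<forall>i\<in>I. r i = r0))"

text \<open>The factor \<open>N + 1\<close> makes the weighted difference of digits a multiple of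
  \<open>N + 1\<close>, so an error of at most \<open>N\<close> can only hide the value 0. The bound
  on \<open>M\<close> exceeds the whole range of difference and error, so a congruence modulo
  \<open>M\<close> is an equality. The translate \<open>a\<close> cancels because both sides carry
  the weight \<open>sum m I\<close>.\<close>

lemma convex_digits_paraboloid:
  assumes D: "0 < D" and N: "0 < N"
    and M: "N * (N + 1) * ((N * D) ^ d * (d * D\<^sup>2 + 1)) \<le> M"
  shows "convex_digits N M (D ^ d) (\<lambda>r. (N + 1) * paraboloid_code (N * D) D d r 0)"
  unfolding convex_digits_def
proof (intro allI impI)
  fix I :: "nat set" and m r :: "nat \<Rightarrow> nat" and r0 a
  assume fin: "finite I" and mr: "\<forall>i\<in>I. 0 < m i \<and> r i < D ^ d" and r0: "r0 < D ^ d"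
    and mN: "sum m I \<le> N"
  define Q where "Q = (\<lambda>r. paraboloid_code (N * D) D d r 0)"
  define X where "X = (N * D) ^ d * (d * D\<^sup>2 + 1)"
  let ?dig = "\<lambda>r. int (((N + 1) * Q r + a) mod M)"
  define w where "w = int (sum m I) * ?dig r0 - (\<Sum>i\<in>I. int (m i) * ?dig (r i))"
  define V where "V = int (sum m I) * int (Q r0) - (\<Sum>i\<in>I. int (m i) * int (Q (r i)))"
  assume "\<bar>int (sum m I) * int (((N + 1) * paraboloid_code (N * D) D d r0 0 + a) mod M)
       - (\<Sum>i\<in>I. int (m i) * int (((N + 1) * paraboloid_code (N * D) D d (r i) 0 + a) mod M))\<bar>
        \<le> int N"
  then have w: "\<bar>w\<bar> \<le> int N" unfolding w_def Q_def .
  have QX: "Q r \<le> X - 1" for r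
    using paraboloid_code_less[OF D N, of d r 0] by (simp add: Q_def X_def)
  have "0 < X" unfolding X_def using D N by (intro mult_pos_pos) auto
  then have X1: "1 \<le> X" by simp
  have "int M dvd (((N + 1) * Q r + a) - ?dig r)" for r
    by (simp add: of_nat_mod minus_mod_eq_mult_div)
  then have dig: "int M dvd int (m i) * (((N + 1) * Q r + a) - ?dig r)" for r i
    by (rule dvd_mult)
  have "int M dvd int (sum m I) * (((N + 1) * Q r0 + a) - ?dig r0)
     - (\<Sum>i\<in>I. int (m i) * (((N + 1) * Q (r i) + a) - ?dig (r i)))"
    by (intro dvd_diff dvd_sum dig) (use \<open>\<And>r. int M dvd (((N + 1) * Q r + a) - ?dig r)\<close> in \<open>rule dvd_mult\<close>)
  also have "\<dots> = (int N + 1) * V - w"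
    unfolding V_def w_def
    by (simp add: algebra_simps sum.distrib sum_subtractf sum_distrib_left sum_distrib_right)
  finally have dvd: "int M dvd (int N + 1) * V - w" .
  have "int (sum m I) * int (Q r0) \<le> int N * int (X - 1)"
    using mN QX by (intro mult_mono) (auto simp del: of_nat_sum)
  moreover have "(\<Sum>i\<in>I. int (m i) * int (Q (r i))) \<le> (\<Sum>i\<in>I. int (m i) * int (X - 1))"
    using QX by (intro sum_mono mult_left_mono) auto
  moreover have "(\<Sum>i\<in>I. int (m i) * int (X - 1)) = int (sum m I) * int (X - 1)"
    by (simp add: sum_distrib_right)
  moreover have "int (sum m I) * int (X - 1) \<le> int N * int (X - 1)"
    using mN by (intro mult_right_mono) (auto simp del: of_nat_sum)
  moreover have "0 \<le> int (sum m I) * int (Q r0)"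
    by (intro mult_nonneg_nonneg of_nat_0_le_iff)
  moreover have "0 \<le> (\<Sum>i\<in>I. int (m i) * int (Q (r i)))"
    by (intro sum_nonneg mult_nonneg_nonneg of_nat_0_le_iff)
  ultimately have V: "\<bar>V\<bar> \<le> int N * int (X - 1)" unfolding V_def by linarith
  have "\<bar>(int N + 1) * V - w\<bar> \<le> (int N + 1) * \<bar>V\<bar> + int N"
    using w abs_triangle_ineq4[of "(int N + 1) * V" w] by (simp add: abs_mult)
  also have "\<dots> \<le> (int N + 1) * (int N * int (X - 1)) + int N"
    using V by (intro add_right_mono mult_left_mono) auto
  also have "\<dots> < (int N + 1) * (int N * int X)"
    using X1 N by (simp add: of_nat_diff algebra_simps)
  also have "\<dots> = int (N * (N + 1) * X)" by (simp add: algebra_simps)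
  also have "\<dots> \<le> int M" using M by (simp only: X_def of_nat_le_iff)
  finally have "(int N + 1) * V = w"
    using dvd zdvd_imp_le[of "int M" "\<bar>(int N + 1) * V - w\<bar>"] by fastforce
  then have eq: "\<bar>w\<bar> = (int N + 1) * \<bar>V\<bar>" by (auto simp: abs_mult)
  have "V = 0"
  proof (rule ccontr)
    assume "V \<noteq> 0"
    then have "(int N + 1) * 1 \<le> (int N + 1) * \<bar>V\<bar>" by (intro mult_left_mono) auto
    then have "int N + 1 \<le> \<bar>w\<bar>" unfolding eq mult_1_right .
    then show False using w by linarith
  qed
  then have "int (sum m I * Q r0) = int (\<Sum>i\<in>I. m i * Q (r i))"
    unfolding V_def by simp
  then have "sum m I * Q r0 = (\<Sum>i\<in>I. m i * Q (r i))" by linarith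
  then show "\<forall>i\<in>I. r i = r0"
    using paraboloid_code_convex[of I m N D d r0 0 r "\<lambda>_. 0"] fin mr mN D r0
    unfolding Q_def by auto
qed

text \<open>Dimension \<open>k\<close> and side \<open>2 ^ (k\<^sup>2)\<close> give a digit count
  with exponent \<open>k ^ 3\<close>, while the base needs exponent
  \<open>k ^ 3 + 3 * k\<^sup>2 + 3 * k\<close>, one less than \<open>(k + 1) ^ 3\<close>. The loss
  is of lower order.\<close>

lemma convex_digits_exist:
  fixes n :: nat
  defines "k \<equiv> n + 1"
  shows "\<exists>A. convex_digits k (2 ^ ((k + 1) ^ 3)) (2 ^ (k ^ 3)) A"
proof -
  let ?D = "2 ^ (k\<^sup>2) :: nat"
  have k: "k < 2 ^ k" "k + 1 \<le> 2 ^ k" 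
    using less_exp[of k] by (auto simp del: less_exp simp: Suc_le_eq)
  have "k * (k + 1) * ((k * ?D) ^ k * (k * ?D\<^sup>2 + 1))
      \<le> 2 ^ k * 2 ^ k * ((2 ^ k * ?D) ^ k * ((k + 1) * ?D\<^sup>2))"
    using k by (intro mult_mono power_mono) auto
  also have "\<dots> \<le> 2 ^ k * 2 ^ k * ((2 ^ k * ?D) ^ k * (2 ^ k * ?D\<^sup>2))"
    using k by (intro mult_mono power_mono) auto
  also have "\<dots> = 2 ^ (k ^ 3 + 3 * k\<^sup>2 + 3 * k)"
    by (simp flip: power_add power_mult add: power2_eq_square power3_eq_cube algebra_simps)
  also have "\<dots> \<le> 2 ^ ((k + 1) ^ 3)"
    by (intro power_increasing) (auto simp: power2_eq_square power3_eq_cube algebra_simps)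
  finally have "convex_digits k (2 ^ ((k + 1) ^ 3)) (?D ^ k) (\<lambda>r. (k + 1) * paraboloid_code (k * ?D) ?D k r 0)"
    by (intro convex_digits_paraboloid) (auto simp: k_def)
  then show ?thesis by (auto simp flip: power_mult simp: power2_eq_square power3_eq_cube)
qed

section \<open>Derandomised choice of translates\<close>

text \<open>The linear term vanishes on averaging centred variables, so each choice costs the
  exponential moment only a factor \<open>1 + (\<eta> * C)\<^sup>2\<close>.\<close>

lemma exp_le_quadratic:
  fixes x :: real
  assumes "\<bar>x\<bar> \<le> 1"
  shows "exp x \<le> 1 + x + x\<^sup>2"
proof (cases "0 \<le> x")
  case True
  then show ?thesis using exp_bound assms by auto
next
  case False
  define y where "y = - x"
  have y: "0 \<le> y" "y \<le> 1" using False assms by (auto simp: y_def)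
  have *: "1 + y + y\<^sup>2 / 2 \<le> exp y" using y by (rule_tac exp_lower_Taylor_quadratic) auto
  have "1 \<le> 1 + y\<^sup>2 / 2 + y ^ 3 / 2 + y ^ 4 / 2" using y by simp
  also have "\<dots> = (1 - y + y\<^sup>2) * (1 + y + y\<^sup>2 / 2)"
    by (simp add: field_simps power2_eq_square power3_eq_cube power4_eq_xxxx)
  also have "\<dots> \<le> (1 - y + y\<^sup>2) * exp y"
    using * y by (intro mult_left_mono) auto
  finally have "exp (- y) \<le> 1 - y + y\<^sup>2"
    by (simp add: exp_minus field_simps)
  then show ?thesis by (simp add: y_def)
qed

text \<open>The method of conditional expectations: each choice keeps the exponential moment
  below its average.\<close>

lemma derandomised_choice:
  fixes y :: "nat \<Rightarrow> nat \<Rightarrow> 'i \<Rightarrow> real"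
  assumes "finite F" "0 < M" "0 \<le> \<eta>" "\<eta> * C \<le> 1"
    and bound: "\<And>j a i. \<bar>y j a i\<bar> \<le> C"
    and mean: "\<And>j i. (\<Sum>a<M. y j a i) = 0"
  shows "\<exists>a. (\<Sum>i\<in>F. exp (\<eta> * (\<Sum>j<P. y j (a j) i))) \<le> card F * exp ((\<eta> * C)\<^sup>2 * P)"
proof (induction P)
  case 0
  then show ?case by simp
next
  case (Suc P)
  then obtain a where a: "(\<Sum>i\<in>F. exp (\<eta> * (\<Sum>j<P. y j (a j) i))) \<le> card F * exp ((\<eta> * C)\<^sup>2 * P)"
    by blast
  define w where "w = (\<lambda>i. exp (\<eta> * (\<Sum>j<P. y j (a j) i)))"
  have w0: "0 \<le> w i" for i by (simp add: w_def)
  define V where "V = (\<lambda>b. \<Sum>i\<in>F. w i * exp (\<eta> * y P b i))"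
  have e: "exp (\<eta> * y P b i) \<le> 1 + \<eta> * y P b i + (\<eta> * C)\<^sup>2" for b i
  proof -
    have le: "\<bar>\<eta> * y P b i\<bar> \<le> \<eta> * C"
      using bound[of P b i] assms(3) by (simp add: abs_mult mult_left_mono)
    then have "(\<eta> * y P b i)\<^sup>2 \<le> (\<eta> * C)\<^sup>2" by (rule abs_le_square_iff[THEN iffD1, OF order_trans]) simp
    then show ?thesis using exp_le_quadratic[of "\<eta> * y P b i"] le assms(4) by linarith
  qed
  have "(\<Sum>b<M. V b) = (\<Sum>i\<in>F. w i * (\<Sum>b<M. exp (\<eta> * y P b i)))"
    unfolding V_def by (subst sum.swap) (simp add: sum_distrib_left)
  also have "\<dots> \<le> (\<Sum>i\<in>F. w i * (\<Sum>b<M. 1 + \<eta> * y P b i + (\<eta> * C)\<^sup>2))"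
    using e w0 by (intro sum_mono mult_left_mono) auto
  also have "\<dots> = (\<Sum>b<M. (1 + (\<eta> * C)\<^sup>2) * sum w F)"
    using mean by (simp add: sum.distrib sum_distrib_left[symmetric] sum_distrib_right[symmetric] algebra_simps)
  finally have "\<exists>b\<in>{..<M}. V b \<le> (1 + (\<eta> * C)\<^sup>2) * sum w F"
    using assms(2) by (metis (no_types, lifting) empty_iff finite_lessThan lessThan_iff linorder_not_le sum_strict_mono)
  then obtain b where "V b \<le> (1 + (\<eta> * C)\<^sup>2) * sum w F" by blast
  also have "\<dots> \<le> exp ((\<eta> * C)\<^sup>2) * (card F * exp ((\<eta> * C)\<^sup>2 * P))"
    using a w0 by (intro mult_mono) (auto simp: w_def intro: sum_nonneg)
  also have "\<dots> = card F * exp ((\<eta> * C)\<^sup>2 * Suc P)"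
    by (simp add: algebra_simps flip: exp_add)
  finally have "V b \<le> card F * exp ((\<eta> * C)\<^sup>2 * Suc P)" .
  moreover have "(\<Sum>j<Suc P. y j ((a(P := b)) j) i) = (\<Sum>j<P. y j (a j) i) + y P b i" for i
    by (simp add: lessThan_Suc)
  ultimately show ?case
    by (intro exI[of _ "a(P := b)"]) (simp add: V_def w_def distrib_left exp_add)
qed

section \<open>Bounds uniform in the frequency\<close>

lemma norm_cis_diff_le: "norm (cis a - cis b) \<le> \<bar>a - b\<bar>"
proof -
  have "cis a - cis b = cis b * (iexp (a - b) - 1)"
    by (simp add: cis_conv_exp right_diff_distrib algebra_simps flip: exp_add)
  then have "norm (cis a - cis b) = norm (iexp (a - b) - 1)" by (simp add: norm_mult)
  also have "\<dots> \<le> \<bar>a - b\<bar>" using iexp_approx1[of "a - b" 0] by simp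
  finally show ?thesis .
qed

text \<open>Makes the deviations centred: as the translate varies, a given digit meets every residue
  once.\<close>

lemma sum_shift_mod:
  fixes f :: "nat \<Rightarrow> 'a::comm_monoid_add"
  assumes "0 < M"
  shows "(\<Sum>a<M. f ((s + a) mod M)) = (\<Sum>b<M. f b)"
proof -
  have inj: "inj_on (\<lambda>a. (s + a) mod M) {..<M}"
  proof (rule inj_onI)
    fix a b assume ab: "a \<in> {..<M}" "b \<in> {..<M}" and eq: "(s + a) mod M = (s + b) mod M"
    then have "(int s + int a) mod int M = (int s + int b) mod int M"
      by (metis of_nat_add of_nat_mod)
    then have "int M dvd int a - int b" by (simp add: mod_eq_dvd_iff)
    then show "a = b" using ab zdvd_imp_le[of "int M" "\<bar>int a - int b\<bar>"] by force
  qed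
  moreover have "(\<lambda>a. (s + a) mod M) ` {..<M} \<subseteq> {..<M}" using assms by auto
  ultimately have "bij_betw (\<lambda>a. (s + a) mod M) {..<M} {..<M}"
    by (simp add: bij_betw_def endo_inj_surj)
  then show ?thesis by (rule sum.reindex_bij_betw)
qed

text \<open>Controlling a finite net of frequencies costs only the logarithm of its size. All
  exponents are integers below \<open>L * M\<close>, so periodicity and a Lipschitz estimate extend
  the bound from the net to every real \<open>\<theta>\<close>.\<close>

lemma translates_choice:
  fixes t A :: "nat \<Rightarrow> nat" and P c M L :: nat
  assumes pos: "0 < P" "0 < c" "0 < M" "0 < L" and t: "\<And>j. t j < L" and PL: "P \<le> L"
  defines "e \<equiv> \<lambda>\<theta> k. cis (- (\<theta> * real k))"
  defines "Z \<equiv> \<lambda>\<theta> j a. (\<Sum>r<c. e \<theta> (t j * M + (A r + a) mod M)) / of_nat c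
                     - (\<Sum>b<M. e \<theta> (t j * M + b)) / of_nat M"
  shows "\<exists>a. \<forall>\<theta>. norm (\<Sum>j<P. Z \<theta> j (a j)) \<le> sqrt P * (4 * ln (32 * (real (L * M))\<^sup>2) + 6)"
proof -
  define K where "K = L * M"
  have K: "0 < K" using pos by (simp add: K_def)
  have PK: "P \<le> K" using PL pos by (simp add: K_def) (metis Suc_leI mult_le_mono nat_mult_1_right One_nat_def)
  \<comment> \<open>Net points \<open>l / K\<^sup>2\<close> run through \<open>[0, 8)\<close>, which
    contains the period \<open>[0, 2 * pi)\<close>. The second index is the power of
    \<open>\<i>\<close> in \<open>y\<close>: one-sided bounds in four directions control real and
    imaginary part.\<close>
  define F where "F = {..<8 * K\<^sup>2} \<times> {..<4::nat}"
  have cardF: "card F = 32 * K\<^sup>2" by (simp add: F_def)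
  have avg: "norm ((\<Sum>i<n. f i) / of_nat n) \<le> B" if "0 < n" "\<And>i. i < n \<Longrightarrow> norm (f i) \<le> B"
    for f :: "nat \<Rightarrow> complex" and n and B
  proof -
    have "norm (\<Sum>i<n. f i) \<le> n * B"
      using sum_norm_bound[of "{..<n}" f B] that by auto
    then show ?thesis using that by (simp add: norm_divide field_simps)
  qed
  have Z2: "norm (Z \<theta> j a) \<le> 2" for \<theta> j a
  proof -
    have "norm (Z \<theta> j a) \<le> 1 + 1"
      unfolding Z_def by (rule norm_triangle_le_diff, rule add_mono; rule avg) (auto simp: pos e_def)
    then show ?thesis by simp
  qed
  have Zmean: "(\<Sum>a<M. Z \<theta> j a) = 0" for \<theta> j
  proof -
    have "(\<Sum>a<M. \<Sum>r<c. e \<theta> (t j * M + (A r + a) mod M))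
        = (\<Sum>r<c. \<Sum>b<M. e \<theta> (t j * M + b))"
      by (subst sum.swap, intro sum.cong refl sum_shift_mod) (rule pos)
    then show ?thesis
      using pos by (simp add: Z_def sum_subtractf flip: sum_divide_distrib)
  qed
  define y where "y = (\<lambda>j a i. Re (\<i> ^ snd i * Z (real (fst i) / (real K)\<^sup>2) j a))"
  have ybound: "\<bar>y j a i\<bar> \<le> 2" for j a i
  proof -
    have "\<bar>y j a i\<bar> \<le> norm (\<i> ^ snd i * Z (real (fst i) / (real K)\<^sup>2) j a)"
      unfolding y_def by (rule abs_Re_le_cmod)
    also have "\<dots> \<le> 2" using Z2 by (simp add: norm_mult norm_power)
    finally show ?thesis .
  qed
  have ymean: "(\<Sum>a<M. y j a i) = 0" for j i
    unfolding y_def by (simp add: Zmean flip: Re_sum sum_distrib_left del: times_complex.sel)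
  \<comment> \<open>Balances the moment: the exponent \<open>(\<eta> * 2)\<^sup>2 * P\<close>
    becomes 1, and taking logarithms costs a factor \<open>1 / \<eta> = 2 * sqrt P\<close>.\<close>
  define \<eta> where "\<eta> = 1 / (2 * sqrt P)"
  have sP: "1 \<le> sqrt P" using pos by simp
  have \<eta>: "0 < \<eta>" "\<eta> * 2 \<le> 1" using sP by (auto simp: \<eta>_def)
  obtain a where a: "(\<Sum>i\<in>F. exp (\<eta> * (\<Sum>j<P. y j (a j) i))) \<le> card F * exp ((\<eta> * 2)\<^sup>2 * P)"
    using derandomised_choice[of F M \<eta> 2 y P] ybound ymean \<eta> pos by (auto simp: F_def)
  have ex1: "(\<eta> * 2)\<^sup>2 * P = 1" using pos by (simp add: \<eta>_def power_divide)
  let ?W = "\<lambda>\<theta>. \<Sum>j<P. Z \<theta> j (a j)"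
  let ?l = "ln (32 * (real K)\<^sup>2)"
  have coord: "(\<Sum>j<P. y j (a j) i) \<le> sqrt P * (2 * ?l + 2)" if "i \<in> F" for i
  proof -
    have "exp (\<eta> * (\<Sum>j<P. y j (a j) i)) \<le> (\<Sum>i\<in>F. exp (\<eta> * (\<Sum>j<P. y j (a j) i)))"
      using that by (intro member_le_sum) (auto simp: F_def)
    also have "\<dots> \<le> 32 * (real K)\<^sup>2 * exp 1" using a unfolding ex1 by (simp add: cardF)
    also have "\<dots> = exp (?l + 1)" using K by (simp add: exp_add)
    finally have "\<eta> * (\<Sum>j<P. y j (a j) i) \<le> ?l + 1" by simp
    then show ?thesis using sP by (simp add: \<eta>_def field_simps)
  qed
  have net: "norm (?W (real l / (real K)\<^sup>2)) \<le> sqrt P * (4 * ?l + 4)" if l: "l < 8 * K\<^sup>2" for l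
  proof -
    let ?w = "?W (real l / (real K)\<^sup>2)"
    have s: "Re (\<i> ^ s * ?w) \<le> sqrt P * (2 * ?l + 2)" if "s < 4" for s
      using coord[of "(l, s)"] l that by (simp add: y_def F_def sum_distrib_left)
    have "\<bar>Re ?w\<bar> \<le> sqrt P * (2 * ?l + 2)" "\<bar>Im ?w\<bar> \<le> sqrt P * (2 * ?l + 2)"
      using s[of 0] s[of 1] s[of 2] s[of 3] by (auto simp: power3_eq_cube abs_le_iff)
    then show ?thesis using cmod_le[of ?w] by (simp add: algebra_simps)
  qed
  have lip: "norm (Z \<theta> j a - Z \<theta>' j a) \<le> 2 * real K * \<bar>\<theta> - \<theta>'\<bar>" for \<theta> \<theta>' j a
  proof -
    have el: "norm (e \<theta> k - e \<theta>' k) \<le> real K * \<bar>\<theta> - \<theta>'\<bar>" if "k < K" for k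
    proof -
      have "norm (e \<theta> k - e \<theta>' k) \<le> \<bar>(\<theta>' - \<theta>) * k\<bar>"
        unfolding e_def using norm_cis_diff_le[of "- (\<theta> * real k)" "- (\<theta>' * real k)"] by (simp add: algebra_simps)
      also have "\<dots> \<le> \<bar>\<theta> - \<theta>'\<bar> * K" using that by (simp add: abs_mult abs_minus_commute mult_left_mono)
      finally show ?thesis by (simp add: mult.commute)
    qed
    have less: "t j * M + b < K" if "b < M" for b
    proof -
      have "t j * M + b < Suc (t j) * M" using that by simp
      also have "\<dots> \<le> L * M" using t[of j] by (intro mult_right_mono) auto
      finally show ?thesis by (simp add: K_def)
    qed
    have "Z \<theta> j a - Z \<theta>' j a = (\<Sum>r<c. e \<theta> (t j * M + (A r + a) mod M) - e \<theta>' (t j * M + (A r + a) mod M)) / of_nat c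
                     - (\<Sum>b<M. e \<theta> (t j * M + b) - e \<theta>' (t j * M + b)) / of_nat M"
      by (simp add: Z_def sum_subtractf diff_divide_distrib)
    also have "norm \<dots> \<le> real K * \<bar>\<theta> - \<theta>'\<bar> + real K * \<bar>\<theta> - \<theta>'\<bar>"
      by (rule norm_triangle_le_diff, rule add_mono; rule avg) (auto simp: pos intro!: el less)
    finally show ?thesis by simp
  qed
  have per: "Z (\<theta> + 2 * pi * of_int z) j a = Z \<theta> j a" for \<theta> z j a
  proof -
    have "e (\<theta> + 2 * pi * of_int z) k = e \<theta> k" for k
    proof -
      have "e (\<theta> + 2 * pi * of_int z) k = e \<theta> k * cis (2 * pi * of_int (- z * int k))"
        unfolding e_def cis_mult by (simp add: algebra_simps)
      also have "cis (2 * pi * of_int (- z * int k)) = 1" by (rule cis_multiple_2pi) simp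
      finally show ?thesis by simp
    qed
    then show ?thesis by (simp add: Z_def)
  qed
  have "norm (?W \<theta>) \<le> sqrt P * (4 * ?l + 6)" for \<theta>
  proof -
    define z where "z = \<lfloor>\<theta> / (2 * pi)\<rfloor>"
    define \<theta>0 where "\<theta>0 = \<theta> - 2 * pi * of_int z"
    have "of_int z \<le> \<theta> / (2 * pi)" "\<theta> / (2 * pi) < of_int z + 1" unfolding z_def by linarith+
    then have \<theta>0: "0 \<le> \<theta>0" "\<theta>0 < 2 * pi" by (auto simp: \<theta>0_def field_simps)
    then have \<theta>8: "\<theta>0 < 8" using pi_less_4 by linarith
    define l where "l = nat \<lfloor>\<theta>0 * (real K)\<^sup>2\<rfloor>"
    have l1: "real l \<le> \<theta>0 * (real K)\<^sup>2" "\<theta>0 * (real K)\<^sup>2 < real l + 1"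
      using \<theta>0 by (auto simp: l_def)
    have K2: "0 < (real K)\<^sup>2" using K by simp
    have "real l < 8 * (real K)\<^sup>2" using l1(1) mult_strict_right_mono[OF \<theta>8 K2] by linarith
    then have "real l < real (8 * K\<^sup>2)" by simp
    then have l8: "l < 8 * K\<^sup>2" by (simp only: of_nat_less_iff)
    have "\<theta>0 - real l / (real K)\<^sup>2 = (\<theta>0 * (real K)\<^sup>2 - real l) / (real K)\<^sup>2"
      using K by (simp add: diff_divide_distrib)
    then have d: "\<bar>\<theta>0 - real l / (real K)\<^sup>2\<bar> \<le> 1 / (real K)\<^sup>2"
      using l1 by (simp add: divide_right_mono)
    \<comment> \<open>Each of the \<open>P\<close> terms has Lipschitz constant \<open>2 * K\<close>
      and the net has spacing \<open>1 / K\<^sup>2\<close>. The error \<open>2 * P / K\<close> is at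
      most \<open>2 * sqrt P\<close> and turns the constant 4 into 6.\<close>
    have "norm (?W \<theta>0 - ?W (real l / (real K)\<^sup>2)) \<le> (\<Sum>j<P. 2 * real K * \<bar>\<theta>0 - real l / (real K)\<^sup>2\<bar>)"
      unfolding sum_subtractf[symmetric] using lip by (rule sum_norm_le)
    also have "\<dots> = real P * (2 * real K * \<bar>\<theta>0 - real l / (real K)\<^sup>2\<bar>)" by simp
    also have "\<dots> \<le> real P * (2 * real K * (1 / (real K)\<^sup>2))"
      by (intro mult_left_mono d) auto
    also have "\<dots> = 2 * (real P / real K)" using K by (simp add: power2_eq_square)
    also have "\<dots> \<le> 2 * sqrt P"
    proof -
      have "real P = sqrt P * sqrt P" by simp
      also have "sqrt P \<le> real P" using sP by (metis mult_le_cancel_left1 calculation order_trans real_sqrt_ge_zero of_nat_0_le_iff linorder_not_le)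
      then have "sqrt P * sqrt P \<le> sqrt P * real K" using PK sP by (intro mult_left_mono) auto
      finally show ?thesis using K by (simp add: field_simps)
    qed
    finally have "norm (?W \<theta>0 - ?W (real l / (real K)\<^sup>2)) \<le> 2 * sqrt P" .
    then have "norm (?W \<theta>0) \<le> sqrt P * (4 * ?l + 4) + 2 * sqrt P"
      using net[OF l8] norm_triangle_sub[of "?W \<theta>0" "?W (real l / (real K)\<^sup>2)"] by linarith
    moreover have "?W \<theta> = ?W \<theta>0" using per[of \<theta>0 z] by (simp add: \<theta>0_def)
    ultimately show ?thesis by (simp add: algebra_simps)
  qed
  then show ?thesis by (auto simp: K_def)
qed

section \<open>Translated Cantor sets\<close>

text \<open>Cell \<open>j\<close> of stage \<open>n\<close> has the children
  \<open>j * c n + r\<close> with \<open>r < c n\<close>, so \<open>div\<close> finds the parent and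
  \<open>mod\<close> the digit index. \<open>T n j\<close> is the left end in units of
  \<open>1 / L n\<close>, and \<open>a n j\<close> is the translate used below this cell
  alone.\<close>

locale digit_tree =
  fixes c M :: "nat \<Rightarrow> nat" and A a T :: "nat \<Rightarrow> nat \<Rightarrow> nat"
  assumes c_gt: "\<And>n. 2 \<le> c n" and M_gt: "\<And>n. 2 \<le> M n"
    and digits: "\<And>n. convex_digits (n + 1) (M n) (c n) (A n)"
    and T_0: "\<And>j. T 0 j = 0"
    and T_Suc: "\<And>n j. T (Suc n) j
      = T n (j div c n) * M n + (A n (j mod c n) + a n (j div c n)) mod M n"
begin

definition P :: "nat \<Rightarrow> nat" where "P n = (\<Prod>k<n. c k)"

definition L :: "nat \<Rightarrow> nat" where "L n = (\<Prod>k<n. M k)"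

lemma P_0 [simp]: "P 0 = 1" and P_Suc: "P (Suc n) = P n * c n"
  by (simp_all add: P_def)

lemma L_0 [simp]: "L 0 = 1" and L_Suc: "L (Suc n) = L n * M n"
  by (simp_all add: L_def)

lemma c_pos [simp]: "0 < c n" using c_gt[of n] by linarith

lemma M_pos [simp]: "0 < M n" using M_gt[of n] by linarith

lemma P_pos [simp]: "0 < P n" by (simp add: P_def prod_pos)

lemma L_pos [simp]: "0 < L n" by (simp add: L_def prod_pos)

lemma P_neq_0 [simp]: "P n \<noteq> 0" and L_neq_0 [simp]: "L n \<noteq> 0"
  using P_pos[of n] L_pos[of n] by (auto simp del: P_pos L_pos)

lemma L_ge: "2 ^ n \<le> L n"
  by (induction n) (auto simp: L_Suc mult.commute intro!: mult_mono M_gt)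

lemma inverse_L_tendsto: "(\<lambda>n. 1 / real (L n)) \<longlonglongrightarrow> 0"
proof (rule tendsto_sandwich[where f = "\<lambda>_. 0"])
  show "(\<lambda>n. (1 / 2) ^ n :: real) \<longlonglongrightarrow> 0" by (rule LIMSEQ_realpow_zero) auto
  have "1 / real (L n) \<le> (1 / 2) ^ n" for n
  proof -
    have "2 ^ n \<le> real (L n)" using L_ge[of n] by (metis of_nat_le_iff of_nat_numeral of_nat_power)
    then show ?thesis by (simp add: power_one_over frac_le)
  qed
  then show "\<forall>\<^sub>F n in sequentially. 1 / real (L n) \<le> (1 / 2) ^ n" by simp
qed auto

lemma div_less_P: "j < P (Suc n) \<Longrightarrow> j div c n < P n"
  by (simp add: P_Suc less_mult_imp_div_less)

text \<open>A gap of 2 is needed because cells are closed of unit length in this scale, and children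
  of adjacent parents could touch. Below one parent it follows from \<open>digits\<close> for a
  single index, the tolerated error \<open>n + 1\<close> being at least 1.\<close>

lemma T_separated:
  assumes "j < P n" "j' < P n" "j \<noteq> j'"
  shows "2 \<le> \<bar>int (T n j) - int (T n j')\<bar>"
  using assms
proof (induction n arbitrary: j j')
  case 0
  then show ?case by simp
next
  case (Suc n)
  define d where "d = (\<lambda>j. (A n (j mod c n) + a n (j div c n)) mod M n)"
  have T: "int (T (Suc n) j) = int (T n (j div c n)) * int (M n) + int (d j)" for j
    by (simp add: T_Suc d_def)
  have d: "0 \<le> int (d j)" "int (d j) < int (M n)" for j
    unfolding d_def by (metis of_nat_0_le_iff, simp only: of_nat_less_iff, simp)
  show ?case
  proof (cases "j div c n = j' div c n")
    case True
    then have ne: "j' mod c n \<noteq> j mod c n" using Suc.prems by (metis div_mult_mod_eq)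
    have "\<not> \<bar>int (d j) - int (d j')\<bar> \<le> 1"
    proof
      assume "\<bar>int (d j) - int (d j')\<bar> \<le> 1"
      then have "\<forall>i\<in>{0::nat}. j' mod c n = j mod c n"
        using digits[of n, unfolded convex_digits_def, rule_format,
            of "{0}" "\<lambda>_. 1" "\<lambda>_. j' mod c n" "j mod c n" "a n (j div c n)"] True
        by (simp add: d_def)
      then show False using ne by simp
    qed
    then show ?thesis using True by (simp add: T)
  next
    case False
    have "2 \<le> \<bar>int (T n (j div c n)) - int (T n (j' div c n))\<bar>"
      using Suc.IH Suc.prems False div_less_P by blast
    then have "2 * int (M n) \<le> \<bar>int (T n (j div c n)) - int (T n (j' div c n))\<bar> * int (M n)"
      by (intro mult_right_mono) auto
    also have "\<dots> = \<bar>int (T n (j div c n)) * int (M n) - int (T n (j' div c n)) * int (M n)\<bar>"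
      by (simp add: abs_mult flip: left_diff_distrib)
    finally show ?thesis using d[of j] d[of j'] M_gt[of n] unfolding T by linarith
  qed
qed

section \<open>Cells and zeros of forms in the limit set\<close>

definition cell :: "nat \<Rightarrow> nat \<Rightarrow> real set" where
  "cell n j = {real (T n j) / real (L n) .. (real (T n j) + 1) / real (L n)}"

definition limit_set :: "real set" where
  "limit_set = (\<Inter>n. \<Union>j<P n. cell n j)"

lemma in_cell_iff:
  "x \<in> cell n j \<longleftrightarrow> real (T n j) \<le> x * real (L n) \<and> x * real (L n) \<le> real (T n j) + 1"
  by (simp add: cell_def field_simps)

lemma cell_Suc_subset: "cell (Suc n) j \<subseteq> cell n (j div c n)"
proof
  fix x assume "x \<in> cell (Suc n) j"
  define d where "d = (A n (j mod c n) + a n (j div c n)) mod M n"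
  have dM: "d + 1 \<le> M n" by (simp add: d_def Suc_le_eq)
  then have dM': "real d + 1 \<le> real (M n)" by linarith
  define t where "t = real (T n (j div c n))"
  have "real (T (Suc n) j) = t * real (M n) + real d" by (simp add: T_Suc d_def t_def)
  moreover have "x * real (L (Suc n)) = (x * real (L n)) * real (M n)" by (simp add: L_Suc)
  moreover have "real (T (Suc n) j) \<le> x * real (L (Suc n))"
    "x * real (L (Suc n)) \<le> real (T (Suc n) j) + 1"
    using \<open>x \<in> cell (Suc n) j\<close> in_cell_iff by blast+
  ultimately have "t * real (M n) \<le> (x * real (L n)) * real (M n)"
    "(x * real (L n)) * real (M n) \<le> (t + 1) * real (M n)"
    using dM' unfolding distrib_right by linarith+
  then show "x \<in> cell n (j div c n)"
    unfolding in_cell_iff t_def by (simp add: mult_le_cancel_right)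
qed

lemma cells_separated:
  assumes "x \<in> cell n j" "y \<in> cell n j'" "j < P n" "j' < P n" "j \<noteq> j'"
  shows "1 / real (L n) \<le> \<bar>x - y\<bar>"
proof -
  have "1 \<le> \<bar>x * real (L n) - y * real (L n)\<bar>"
    using T_separated[OF assms(3-5)] assms(1,2) by (auto simp: in_cell_iff)
  also have "\<dots> = \<bar>x - y\<bar> * real (L n)" by (simp add: abs_mult flip: left_diff_distrib)
  finally show ?thesis by (simp add: field_simps)
qed

lemma closed_limit_set: "closed limit_set"
  unfolding limit_set_def cell_def by (intro closed_INT ballI closed_UN) auto

lemma limit_set_subset: "limit_set \<subseteq> {0..1}"
proof -
  have "limit_set \<subseteq> (\<Union>j<P 0. cell 0 j)" unfolding limit_set_def by blast
  then show ?thesis by (simp add: cell_def T_0 lessThan_Suc)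
qed

text \<open>At stage \<open>N\<close> closeness to \<open>x 0\<close> leaves only one cell. Within a
  common cell the form annihilates the shared offset, so on the child digits it takes a value of
  size at most \<open>m 0\<close>, due to the positions inside the children. \<open>digits\<close>
  tolerates this error.\<close>

lemma limit_set_common_cell:
  assumes x: "\<And>i. i \<le> v \<Longrightarrow> x i \<in> limit_set"
    and m: "\<And>i. i \<in> {1..v} \<Longrightarrow> 0 < m i" "m 0 = sum m {1..v}" "m 0 \<le> N"
    and zero: "lin_form v m x = 0"
    and close: "\<And>i. i \<le> v \<Longrightarrow> \<bar>x i - x 0\<bar> < 1 / real (L N)"
  shows "\<exists>j<P (N + k). \<forall>i\<le>v. x i \<in> cell (N + k) j"
proof (induction k)
  case 0
  obtain j where j: "j < P N" "x 0 \<in> cell N j" using x[of 0] by (auto simp: limit_set_def)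
  have "x i \<in> cell N j" if i: "i \<le> v" for i
  proof -
    obtain j' where j': "j' < P N" "x i \<in> cell N j'" using x[OF i] by (auto simp: limit_set_def)
    then have "j' = j" using cells_separated[of "x i" N j' "x 0" j] j close[OF i] by force
    then show ?thesis using j' by simp
  qed
  then show ?case using j by auto
next
  case (Suc k)
  define n where "n = N + k"
  obtain j where j: "j < P n" "\<And>i. i \<le> v \<Longrightarrow> x i \<in> cell n j" using Suc n_def by blast
  have "\<forall>i. \<exists>J. i \<le> v \<longrightarrow> J < P (Suc n) \<and> x i \<in> cell (Suc n) J"
    using x unfolding limit_set_def by blast
  then obtain J where J: "\<And>i. i \<le> v \<Longrightarrow> J i < P (Suc n)" "\<And>i. i \<le> v \<Longrightarrow> x i \<in> cell (Suc n) (J i)"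
    by metis
  have Jdiv: "J i div c n = j" if i: "i \<le> v" for i
  proof (rule ccontr)
    assume "J i div c n \<noteq> j"
    then have "1 / real (L n) \<le> \<bar>x i - x i\<bar>"
      using cells_separated[of "x i" n "J i div c n" "x i" j] J[OF i] j i div_less_P cell_Suc_subset
      by blast
    then show False by simp
  qed
  define d where "d = (\<lambda>i. (A n (J i mod c n) + a n j) mod M n)"
  \<comment> \<open>Position of \<open>x i\<close> inside its child cell, in units of the child's
    length.\<close>
  define t where "t = (\<lambda>i. x i * real (L (Suc n)) - real (T n j * M n) - real (d i))"
  have t: "0 \<le> t i" "t i \<le> 1" if "i \<le> v" for i
    using J(2)[OF that] Jdiv[OF that] by (auto simp: in_cell_iff t_def d_def T_Suc)
  have sm: "real (m 0) = (\<Sum>i=1..v. real (m i))" using m(2) by simp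
  have "real (m 0) * t 0 - (\<Sum>i=1..v. real (m i) * t i)
      = lin_form v m x * real (L (Suc n)) - real (m 0) * real (T n j * M n)
        + (\<Sum>i=1..v. real (m i)) * real (T n j * M n)
        - (real (m 0) * real (d 0) - (\<Sum>i=1..v. real (m i) * real (d i)))"
    unfolding lin_form_def t_def
    by (simp add: algebra_simps sum.distrib sum_subtractf sum_distrib_left sum_distrib_right)
  also have "\<dots> = - (real (m 0) * real (d 0) - (\<Sum>i=1..v. real (m i) * real (d i)))"
    unfolding zero sm by simp
  finally have dt: "real (m 0) * real (d 0) - (\<Sum>i=1..v. real (m i) * real (d i))
      = (\<Sum>i=1..v. real (m i) * t i) - real (m 0) * t 0" by simp
  have "(\<Sum>i=1..v. real (m i) * t i) \<le> (\<Sum>i=1..v. real (m i) * 1)"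
    using t by (intro sum_mono mult_left_mono) auto
  then have "(\<Sum>i=1..v. real (m i) * t i) \<le> real (m 0)" using sm by simp
  moreover have "0 \<le> (\<Sum>i=1..v. real (m i) * t i)" using t by (intro sum_nonneg) auto
  moreover have "0 \<le> real (m 0) * t 0" "real (m 0) * t 0 \<le> real (m 0)"
    using t[of 0] by (auto simp: mult_left_le)
  ultimately have "\<bar>real (m 0) * real (d 0) - (\<Sum>i=1..v. real (m i) * real (d i))\<bar> \<le> real (m 0)"
    unfolding dt by linarith
  then have "\<bar>real_of_int (int (m 0) * int (d 0) - (\<Sum>i=1..v. int (m i) * int (d i)))\<bar> \<le> real_of_int (int (m 0))"
    by simp
  then have "\<bar>int (m 0) * int (d 0) - (\<Sum>i=1..v. int (m i) * int (d i))\<bar> \<le> int (m 0)"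
    by linarith
  \<comment> \<open>As \<open>m 0 \<le> N \<le> n\<close>, weight and error both respect the bound
    \<open>n + 1\<close> of stage \<open>n\<close>.\<close>
  then have "\<bar>int (sum m {1..v}) * int (d 0) - (\<Sum>i=1..v. int (m i) * int (d i))\<bar> \<le> int (n + 1)"
    using m(2,3) by (simp add: n_def del: of_nat_sum)
  then have "\<forall>i\<in>{1..v}. J i mod c n = J 0 mod c n"
    using digits[of n, unfolded convex_digits_def, rule_format,
        of "{1..v}" m "\<lambda>i. J i mod c n" "J 0 mod c n" "a n j"] m
    by (simp add: n_def d_def del: of_nat_sum of_nat_add of_nat_Suc)
  then have "J i mod c n = J 0 mod c n" if "i \<le> v" for i
    using that by (cases "i = 0") auto
  then have "J i = J 0" if "i \<le> v" for i
    using that Jdiv by (metis div_mult_mod_eq le0)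
  then show ?case using J by (metis add_Suc_right n_def le0)
qed

lemma limit_set_zero_trivial:
  assumes "\<And>i. i \<le> v \<Longrightarrow> x i \<in> limit_set"
    and "\<And>i. i \<in> {1..v} \<Longrightarrow> 0 < m i" "m 0 = sum m {1..v}" "m 0 \<le> N"
    and "lin_form v m x = 0"
    and "\<And>i. i \<le> v \<Longrightarrow> \<bar>x i - x 0\<bar> < 1 / real (L N)"
    and i: "i \<le> v"
  shows "x i = x 0"
proof -
  have "\<bar>x i - x 0\<bar> \<le> 1 / real (L (N + k))" for k
  proof -
    obtain j where "x i \<in> cell (N + k) j" "x 0 \<in> cell (N + k) j"
      using limit_set_common_cell[OF assms(1-6), of k] i by blast
    then show ?thesis by (auto simp: cell_def add_divide_distrib abs_le_iff)
  qed
  moreover have "(\<lambda>k. 1 / real (L (N + k))) \<longlonglongrightarrow> 0"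
    using LIMSEQ_ignore_initial_segment[OF inverse_L_tendsto, of N] by (simp add: add.commute)
  ultimately have "\<bar>x i - x 0\<bar> \<le> 0" by (intro LIMSEQ_le_const) auto
  then show ?thesis by simp
qed

end

section \<open>Fourier decay of the natural measure\<close>

text \<open>The Fourier transform of the uniform distribution on \<open>[0, 1]\<close>, with its
  removable singularity filled in.\<close>

definition interval_transform :: "real \<Rightarrow> complex" where
  "interval_transform t = (if t = 0 then 1 else (1 - cis (- t)) / (\<i> * of_real t))"

lemma norm_one_minus_cis_le: "norm (1 - cis t) \<le> \<bar>t\<bar>"
  using iexp_approx1[of t 0] by (simp add: cis_conv_exp norm_minus_commute)

lemma norm_interval_transform_le_1: "norm (interval_transform t) \<le> 1"
  using norm_one_minus_cis_le[of "- t"]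
  by (auto simp: interval_transform_def norm_divide norm_mult divide_le_eq)

text \<open>Interpolates between the bounds 1 and \<open>2 / \<bar>t\<bar>\<close>, so that every
  stage can contribute the same power of the frequency.\<close>

lemma norm_interval_transform_le_powr:
  assumes "t \<noteq> 0" "0 \<le> p" "p \<le> 1"
  shows "norm (interval_transform t) \<le> (2 / \<bar>t\<bar>) powr p"
proof (cases "2 / \<bar>t\<bar> \<ge> 1")
  case True
  then have "1 \<le> (2 / \<bar>t\<bar>) powr p" using assms by (intro ge_one_powr_ge_zero) auto
  then show ?thesis using norm_interval_transform_le_1[of t] by linarith
next
  case False
  have "norm (1 - cis (- t)) \<le> 2" using norm_triangle_ineq4[of 1 "cis (- t)"] by simp
  then have "norm (interval_transform t) \<le> (2 / \<bar>t\<bar>) powr 1"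
    using assms(1) by (simp add: interval_transform_def norm_divide norm_mult divide_right_mono)
  also have "\<dots> \<le> (2 / \<bar>t\<bar>) powr p" using False assms by (intro powr_mono') auto
  finally show ?thesis .
qed

text \<open>Cutting \<open>[0, M]\<close> into unit intervals produces a geometric sum; this relates
  the smoothing of one stage to that of the next.\<close>

lemma interval_transform_mult:
  assumes "0 < M"
  shows "interval_transform (real M * t)
    = interval_transform t * (\<Sum>b<M. cis (- (t * real b))) / of_nat M"
proof (cases "t = 0")
  case True
  then show ?thesis using assms by (simp add: interval_transform_def)
next
  case False
  have "cis (- (t * real b)) = cis (- t) ^ b" for b
    by (subst Complex.DeMoivre) (simp add: mult.commute)
  then have "(1 - cis (- t)) * (\<Sum>b<M. cis (- (t * real b))) = 1 - cis (- t) ^ M"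
    by (simp add: one_diff_power_eq)
  also have "cis (- t) ^ M = cis (- (real M * t))" by (simp add: Complex.DeMoivre)
  finally show ?thesis using False assms by (simp add: interval_transform_def field_simps)
qed

lemma interval_transform_tendsto:
  assumes "(f \<longlongrightarrow> 0) F"
  shows "((\<lambda>n. interval_transform (f n)) \<longlongrightarrow> 1) F"
proof -
  have bound: "norm (interval_transform t - 1) \<le> \<bar>t\<bar>" for t
  proof (cases "t = 0")
    case False
    define X where "X = iexp (- t) - (\<Sum>k\<le>1. (\<i> * of_real (- t)) ^ k / fact k)"
    have "norm X \<le> t\<^sup>2 / 2"
      unfolding X_def using iexp_approx1[of "- t" 1] by (simp add: power2_eq_square)
    also have "t\<^sup>2 / 2 \<le> t\<^sup>2" by simp
    also have "t\<^sup>2 = \<bar>t\<bar> * \<bar>t\<bar>" by (simp add: power2_eq_square)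
    finally have X: "norm X \<le> \<bar>t\<bar> * \<bar>t\<bar>" .
    have "interval_transform t - 1 = - (X / (\<i> * of_real t))"
      using False by (simp add: X_def interval_transform_def cis_conv_exp field_simps)
    then have "norm (interval_transform t - 1) = norm X / \<bar>t\<bar>"
      by (simp only: norm_minus_cancel norm_divide norm_mult norm_ii norm_of_real mult_1)
    also have "\<dots> \<le> \<bar>t\<bar>" using X False by (subst pos_divide_le_eq) simp_all
    finally show ?thesis .
  qed (simp add: interval_transform_def)
  have "((\<lambda>n. interval_transform (f n) - 1) \<longlongrightarrow> 0) F"
    by (rule Lim_null_comparison[OF _ tendsto_rabs_zero[OF assms]]) (simp add: bound)
  then show ?thesis by (rule LIM_zero_cancel)
qed

section \<open>Step functions on the parameter interval\<close>

lemma nat_floor_mult_div: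
  fixes x :: real
  assumes "0 < c"
  shows "nat \<lfloor>x * real c\<rfloor> div c = nat \<lfloor>x\<rfloor>"
proof (cases "0 \<le> x")
  case True
  have "\<lfloor>x\<rfloor> = \<lfloor>x * real c / real_of_int (int c)\<rfloor>" using assms by simp
  also have "\<dots> = \<lfloor>x * real c\<rfloor> div int c" by (rule floor_divide_real_eq_div) simp
  finally show ?thesis using True by (simp add: nat_div_distrib)
next
  case False
  then have "x * real c \<le> 0" by (simp add: mult_nonpos_nonneg)
  then have "\<lfloor>x * real c\<rfloor> \<le> 0" by (simp add: floor_le_iff)
  then show ?thesis using False by simp
qed

lemma prob_space_unit_interval: "prob_space (restrict_space lborel {0..<1::real})"
  by (rule prob_space_restrict_space) auto

lemma sum_lessThan_mult:
  fixes f :: "nat \<Rightarrow> 'a::comm_monoid_add"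
  shows "(\<Sum>k<p * c. f k) = (\<Sum>j<p. \<Sum>r<c. f (j * c + r))"
proof -
  have "sum f {j * c..<j * c + c} = (\<Sum>r<c. f (j * c + r))" for j
    using sum.shift_bounds_nat_ivl[of f 0 "j * c" c] by (simp add: add.commute lessThan_atLeast0)
  then show ?thesis by (simp flip: sum.nat_group)
qed

lemma integral_step_function:
  fixes g :: "nat \<Rightarrow> complex"
  assumes "0 < p"
  shows "(CLINT u|restrict_space lborel {0..<1}. g (nat \<lfloor>u * real p\<rfloor>)) = (\<Sum>j<p. g j) / of_nat p"
proof -
  let ?I = "\<lambda>j::nat. {real j / real p ..< (real j + 1) / real p}"
  have split: "indicator {0..<1} u *\<^sub>R g (nat \<lfloor>u * real p\<rfloor>) = (\<Sum>j<p. indicator (?I j) u *\<^sub>R g j)" for u :: real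
  proof (cases "0 \<le> u \<and> u < 1")
    case True
    define k where "k = nat \<lfloor>u * real p\<rfloor>"
    have "real_of_int \<lfloor>u * real p\<rfloor> \<le> u * real p" "u * real p < real_of_int \<lfloor>u * real p\<rfloor> + 1"
      by linarith+
    moreover have "0 \<le> \<lfloor>u * real p\<rfloor>" using True by simp
    ultimately have k: "real k \<le> u * real p" "u * real p < real k + 1" by (auto simp: k_def)
    have "u * real p < 1 * real p" using True assms by (intro mult_strict_right_mono) auto
    then have kp: "k < p" using k by linarith
    have iff: "u \<in> ?I j \<longleftrightarrow> j = k" for j
    proof -
      have "u \<in> ?I j \<longleftrightarrow> real j \<le> u * real p \<and> u * real p < real j + 1"
        using assms by (auto simp: field_simps)
      also have "\<dots> \<longleftrightarrow> j = k" using k by auto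
      finally show ?thesis .
    qed
    have "(\<Sum>j<p. indicator (?I j) u *\<^sub>R g j) = (\<Sum>j<p. if j = k then g j else 0)"
      using iff by (intro sum.cong) (auto simp: indicator_def)
    then show ?thesis using kp True by (simp add: k_def)
  next
    case False
    have "u \<notin> ?I j" if "j < p" for j
    proof
      assume "u \<in> ?I j"
      then have "real j / real p \<le> u" "u < (real j + 1) / real p" by (simp_all only: atLeastLessThan_iff)
      moreover have "0 \<le> real j / real p" by simp
      moreover have "(real j + 1) / real p \<le> 1" using that by simp
      ultimately show False using False by linarith
    qed
    then have "(\<Sum>j<p. indicator (?I j) u *\<^sub>R g j) = 0" by (intro sum.neutral) auto
    then show ?thesis using False by auto
  qed
  have "(CLINT u|restrict_space lborel {0..<1}. g (nat \<lfloor>u * real p\<rfloor>))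
      = (CLINT u|lborel. indicator {0..<1} u *\<^sub>R g (nat \<lfloor>u * real p\<rfloor>))"
    by (rule integral_restrict_space) auto
  also have "\<dots> = (CLINT u|lborel. (\<Sum>j<p. indicator (?I j) u *\<^sub>R g j))" by (simp only: split)
  also have "\<dots> = (\<Sum>j<p. CLINT u|lborel. indicator (?I j) u *\<^sub>R g j)"
    by (intro Bochner_Integration.integral_sum integrable_scaleR_left) (auto simp: divide_right_mono)
  also have "\<dots> = (\<Sum>j<p. (1 / real p) *\<^sub>R g j)"
    using assms by (intro sum.cong refl) (simp add: divide_right_mono diff_divide_distrib[symmetric])
  also have "\<dots> = (\<Sum>j<p. g j) / of_nat p"
    by (simp add: scaleR_conv_of_real sum_divide_distrib)
  finally show ?thesis .
qed

section \<open>The natural measure and its exponential sums\<close>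

context digit_tree
begin

text \<open>The leading digits of \<open>u\<close> in the mixed radix \<open>c 0, c 1, ...\<close>,
  read as one number; a uniform \<open>u\<close> selects each of the \<open>P n\<close> cells with
  probability \<open>1 / P n\<close>.\<close>

definition address :: "nat \<Rightarrow> real \<Rightarrow> nat" where
  "address n u = nat \<lfloor>u * real (P n)\<rfloor>"

definition left_end :: "nat \<Rightarrow> real \<Rightarrow> real" where
  "left_end n u = real (T n (address n u)) / real (L n)"

definition point :: "real \<Rightarrow> real" where
  "point u = lim (\<lambda>n. left_end n u)"

text \<open>As an image of Lebesgue measure it needs no limit of measures; the transforms converge
  by dominated convergence.\<close>

definition cantor_measure :: "real measure" where
  "cantor_measure = distr (restrict_space lborel {0..<1}) borel point"

lemma address_div: "address (Suc n) u div c n = address n u"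
  using nat_floor_mult_div[of "c n" "u * real (P n)"] by (simp add: address_def P_Suc mult.assoc)

lemma address_less:
  assumes "0 \<le> u" "u < 1"
  shows "address n u < P n"
proof -
  have "u * real (P n) < 1 * real (P n)" using assms by (intro mult_strict_right_mono) auto
  then show ?thesis using assms by (simp add: address_def nat_less_iff floor_less_iff)
qed

lemma left_end_in_cell:
  assumes "n \<le> m"
  shows "left_end m u \<in> cell n (address n u)"
proof -
  have "decseq (\<lambda>n. cell n (address n u))"
    using cell_Suc_subset by (intro decseq_SucI) (metis address_div)
  then have "cell m (address m u) \<subseteq> cell n (address n u)" using assms by (rule decseqD)
  moreover have "left_end m u \<in> cell m (address m u)"
    by (simp add: left_end_def cell_def divide_right_mono)
  ultimately show ?thesis by blast
qed

lemma left_end_tendsto: "(\<lambda>n. left_end n u) \<longlonglongrightarrow> point u"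
proof -
  have "incseq (\<lambda>n. left_end n u)"
    using left_end_in_cell[of n "Suc n" u for n] by (intro incseq_SucI) (auto simp: cell_def left_end_def)
  moreover have "left_end n u \<le> 1" for n
    using left_end_in_cell[of 0 n u] by (simp add: cell_def T_0)
  ultimately have "convergent (\<lambda>n. left_end n u)"
    by (metis convergentI incseq_convergent)
  then show ?thesis by (simp add: point_def convergent_LIMSEQ_iff)
qed

lemma point_in_limit_set:
  assumes "0 \<le> u" "u < 1"
  shows "point u \<in> limit_set"
proof -
  have "point u \<in> cell n (address n u)" for n
  proof (rule Lim_in_closed_set[OF _ _ _ left_end_tendsto])
    show "\<forall>\<^sub>F m in sequentially. left_end m u \<in> cell n (address n u)"
      using left_end_in_cell by (auto simp: eventually_sequentially)
  qed (auto simp: cell_def)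
  then show ?thesis using address_less[OF assms] by (auto simp: limit_set_def)
qed

lemma measurable_left_end [measurable]: "left_end n \<in> borel_measurable borel"
  unfolding left_end_def address_def by measurable

lemma measurable_point [measurable]: "point \<in> borel_measurable borel"
  by (rule borel_measurable_LIMSEQ_real[OF left_end_tendsto]) measurable

lemma measurable_point_unit: "point \<in> borel_measurable (restrict_space lborel {0..<1})"
  by (intro measurable_restrict_space1) simp

lemma real_distribution_cantor_measure: "real_distribution cantor_measure"
proof -
  interpret prob_space "restrict_space lborel {0..<1::real}" by (rule prob_space_unit_interval)
  show ?thesis unfolding cantor_measure_def using measurable_point_unit by (rule real_distribution_distr)
qed

lemma measure_limit_set: "measure cantor_measure limit_set = 1"
proof -
  interpret prob_space "restrict_space lborel {0..<1::real}" by (rule prob_space_unit_interval)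
  have "limit_set \<in> sets borel" using closed_limit_set by simp
  then have "measure cantor_measure limit_set
      = prob (point -` limit_set \<inter> space (restrict_space lborel {0..<1}))"
    unfolding cantor_measure_def by (intro measure_distr measurable_point_unit)
  also have "point -` limit_set \<inter> space (restrict_space lborel {0..<1}) = space (restrict_space lborel {0..<1})"
    using point_in_limit_set by (auto simp: space_restrict_space)
  finally show ?thesis by (simp only: prob_space)
qed

text \<open>The Fourier transform of equal point masses at the left ends of stage
  \<open>n\<close>.\<close>

definition exp_sum :: "nat \<Rightarrow> real \<Rightarrow> complex" where
  "exp_sum n \<xi> = (\<Sum>j<P n. cis (- (\<xi> / real (L n) * real (T n j)))) / of_nat (P n)"

lemma exp_sum_tendsto: "(\<lambda>n. exp_sum n \<xi>) \<longlonglongrightarrow> fourier_transform cantor_measure \<xi>"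
proof -
  interpret prob_space "restrict_space lborel {0..<1::real}" by (rule prob_space_unit_interval)
  let ?U = "restrict_space lborel {0..<1::real}"
  have cont: "continuous_on UNIV (\<lambda>x. iexp (- (x * \<xi>)))" by (intro continuous_intros)
  have meas: "(\<lambda>x. iexp (- (x * \<xi>))) \<in> borel_measurable borel" using cont by (rule borel_measurable_continuous_onI)
  have "exp_sum n \<xi> = (CLINT u|?U. iexp (- (left_end n u * \<xi>)))" for n
    using integral_step_function[of "P n" "\<lambda>j. iexp (- (real (T n j) / real (L n) * \<xi>))"]
    by (simp add: exp_sum_def left_end_def address_def cis_conv_exp mult.commute)
  moreover have "fourier_transform cantor_measure \<xi> = (CLINT u|?U. iexp (- (point u * \<xi>)))"
    unfolding fourier_transform_def cantor_measure_def
    using measurable_point_unit meas by (rule integral_distr)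
  moreover have "(\<lambda>n. CLINT u|?U. iexp (- (left_end n u * \<xi>))) \<longlonglongrightarrow> (CLINT u|?U. iexp (- (point u * \<xi>)))"
  proof (rule integral_dominated_convergence[where w = "\<lambda>_. 1"])
    show "(\<lambda>u. iexp (- (point u * \<xi>))) \<in> borel_measurable ?U"
      using measurable_compose[OF measurable_point_unit meas] .
    show "(\<lambda>u. iexp (- (left_end n u * \<xi>))) \<in> borel_measurable ?U" for n
      using measurable_compose[OF measurable_left_end meas] by (intro measurable_restrict_space1) simp
    show "AE u in ?U. (\<lambda>n. iexp (- (left_end n u * \<xi>))) \<longlonglongrightarrow> iexp (- (point u * \<xi>))"
      by (intro AE_I2 tendsto_intros left_end_tendsto)
  qed auto
  ultimately show ?thesis by simp
qed

text \<open>The \<open>Z\<close> of \<open>translates_choice\<close>: how far the children of cell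
  \<open>j\<close> deviate from a uniform subdivision.\<close>

definition oscillation :: "nat \<Rightarrow> real \<Rightarrow> nat \<Rightarrow> complex" where
  "oscillation n \<theta> j =
     (\<Sum>r<c n. cis (- (\<theta> * real (T n j * M n + (A n r + a n j) mod M n)))) / of_nat (c n)
     - (\<Sum>b<M n. cis (- (\<theta> * real (T n j * M n + b)))) / of_nat (M n)"

text \<open>Multiplying by the transform of a uniform density turns the atoms of level \<open>n\<close> into
  uniform distributions on cells; the telescoping differences then decay beyond the frequency
  \<open>L (Suc n)\<close>.\<close>

lemma smoothed_exp_sum_Suc:
  "exp_sum (Suc n) \<xi> * interval_transform (\<xi> / real (L (Suc n)))
   = exp_sum n \<xi> * interval_transform (\<xi> / real (L n))
     + (\<Sum>j<P n. oscillation n (\<xi> / real (L (Suc n))) j) / of_nat (P n)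
       * interval_transform (\<xi> / real (L (Suc n)))"
proof -
  define \<theta> where "\<theta> = \<xi> / real (L (Suc n))"
  have \<theta>: "\<xi> / real (L n) = real (M n) * \<theta>" by (simp add: \<theta>_def L_Suc)
  define G where "G = (\<Sum>b<M n. cis (- (\<theta> * real b))) / of_nat (M n)"
  have S: "exp_sum (Suc n) \<xi> = (\<Sum>j<P n. (\<Sum>r<c n. cis (- (\<theta> * real (T n j * M n + (A n r + a n j) mod M n))))
      / of_nat (c n)) / of_nat (P n)"
  proof -
    have child: "T (Suc n) (j * c n + r) = T n j * M n + (A n r + a n j) mod M n" if "r < c n" for j r
      using that by (simp add: T_Suc)
    have "exp_sum (Suc n) \<xi> = (\<Sum>j<P n. \<Sum>r<c n. cis (- (\<theta> * real (T (Suc n) (j * c n + r))))) / of_nat (P n * c n)"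
      unfolding exp_sum_def P_Suc sum_lessThan_mult \<theta>_def ..
    also have "\<dots> = (\<Sum>j<P n. \<Sum>r<c n. cis (- (\<theta> * real (T n j * M n + (A n r + a n j) mod M n)))) / of_nat (P n * c n)"
      by (intro arg_cong2[of _ _ _ _ "(/)"] sum.cong refl) (simp add: child)
    finally show ?thesis by (simp add: mult.commute flip: sum_divide_distrib)
  qed
  \<comment> \<open>A uniform subdivision factors into the parent's term and \<open>G\<close>, the
    same \<open>G\<close> that links the two smoothing transforms.\<close>
  have "(\<Sum>b<M n. cis (- (\<theta> * real (T n j * M n + b)))) / of_nat (M n)
     = cis (- (\<xi> / real (L n) * real (T n j))) * G" for j
    unfolding G_def \<theta> times_divide_eq_right sum_distrib_left cis_mult
    by (simp add: algebra_simps)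
  then have "(\<Sum>j<P n. oscillation n \<theta> j) / of_nat (P n) = exp_sum (Suc n) \<xi> - exp_sum n \<xi> * G"
    unfolding S by (simp add: oscillation_def exp_sum_def sum_subtractf diff_divide_distrib flip: sum_distrib_right)
  moreover have "interval_transform (\<xi> / real (L n)) = interval_transform \<theta> * G"
    unfolding \<theta> G_def by (simp add: interval_transform_mult)
  ultimately show ?thesis unfolding \<theta>_def[symmetric] by (simp only: left_diff_distrib) simp
qed

text \<open>Telescoping starts at stage 0, where the exponential sum is 1. The increment of stage
  \<open>n\<close> is \<open>\<eta> n\<close> times a smoothing factor of size at most
  \<open>(2 / \<bar>\<xi>\<bar> * L (Suc n)) powr (\<beta> / 2)\<close>, whence the summability
  condition. In the limit the smoothing factor tends to 1.\<close>

lemma fourier_decay: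
  assumes osc: "\<And>n \<theta>. norm (\<Sum>j<P n. oscillation n \<theta> j) \<le> real (P n) * \<eta> n"
    and \<beta>: "0 \<le> \<beta>" "\<beta> \<le> 1"
    and sum: "summable (\<lambda>n. \<eta> n * real (L (Suc n)) powr (\<beta> / 2))"
  shows "\<exists>C>0. \<forall>\<xi>. cmod (fourier_transform cantor_measure \<xi>) \<le> C * (1 + \<bar>\<xi>\<bar>) powr (- \<beta> / 2)"
proof -
  define W where "W = (\<Sum>n. \<eta> n * real (L (Suc n)) powr (\<beta> / 2))"
  have \<eta>: "0 \<le> \<eta> n" for n
  proof -
    have "0 \<le> real (P n) * \<eta> n" using osc[of n 0] norm_ge_zero order_trans by blast
    then show ?thesis by (simp add: zero_le_mult_iff)
  qed
  have W: "0 \<le> W" unfolding W_def using sum \<eta> by (intro suminf_nonneg) auto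
  let ?F = "fourier_transform cantor_measure"
  have large: "cmod (?F \<xi>) \<le> (2 / \<bar>\<xi>\<bar>) powr (\<beta> / 2) * (1 + W)" if "\<xi> \<noteq> 0" for \<xi>
  proof -
    let ?b = "(2 / \<bar>\<xi>\<bar>) powr (\<beta> / 2)"
    let ?S = "\<lambda>n. exp_sum n \<xi> * interval_transform (\<xi> / real (L n))"
    let ?w = "\<lambda>k. \<eta> k * real (L (Suc k)) powr (\<beta> / 2)"
    have it: "norm (interval_transform (\<xi> / real (L n))) \<le> ?b * real (L n) powr (\<beta> / 2)" for n
    proof -
      have "norm (interval_transform (\<xi> / real (L n))) \<le> (2 / \<bar>\<xi> / real (L n)\<bar>) powr (\<beta> / 2)"
        using that \<beta> by (intro norm_interval_transform_le_powr) auto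
      also have "\<dots> = (2 / \<bar>\<xi>\<bar> * real (L n)) powr (\<beta> / 2)" by simp
      finally show ?thesis by (simp only: powr_mult)
    qed
    have "norm (?S n) \<le> ?b * (1 + (\<Sum>k<n. ?w k))" for n
    proof (induction n)
      case 0
      have "exp_sum 0 \<xi> = 1" by (simp add: exp_sum_def T_0 lessThan_Suc)
      then show ?case using it[of 0] by simp
    next
      case (Suc n)
      let ?D = "(\<Sum>j<P n. oscillation n (\<xi> / real (L (Suc n))) j) / of_nat (P n)"
      have "norm ?D \<le> \<eta> n"
        using osc[of n "\<xi> / real (L (Suc n))"] by (simp add: norm_divide field_simps)
      then have "norm (?D * interval_transform (\<xi> / real (L (Suc n)))) \<le> \<eta> n * (?b * real (L (Suc n)) powr (\<beta> / 2))"
        unfolding norm_mult using it \<eta> by (intro mult_mono) auto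
      then have "norm (?S (Suc n)) \<le> ?b * (1 + (\<Sum>k<n. ?w k)) + \<eta> n * (?b * real (L (Suc n)) powr (\<beta> / 2))"
        unfolding smoothed_exp_sum_Suc using Suc by (intro norm_triangle_mono)
      then show ?case by (simp add: algebra_simps)
    qed
    also have "?b * (1 + (\<Sum>k<n. ?w k)) \<le> ?b * (1 + W)" for n
      unfolding W_def using sum \<eta> by (intro mult_left_mono add_left_mono sum_le_suminf) auto
    finally have bd: "norm (?S n) \<le> ?b * (1 + W)" for n .
    have "(\<lambda>n. \<xi> / real (L n)) \<longlonglongrightarrow> 0"
      using tendsto_mult_right_zero[OF inverse_L_tendsto, of \<xi>] by simp
    then have "(\<lambda>n. interval_transform (\<xi> / real (L n))) \<longlonglongrightarrow> 1" by (rule interval_transform_tendsto)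
    then have "?S \<longlonglongrightarrow> ?F \<xi> * 1" by (intro tendsto_mult exp_sum_tendsto)
    then have "(\<lambda>n. norm (?S n)) \<longlonglongrightarrow> norm (?F \<xi>)" using tendsto_norm by fastforce
    then show ?thesis using bd by (intro LIMSEQ_le_const2) auto
  qed
  \<comment> \<open>The 4 arises from
    \<open>2 / \<bar>\<xi>\<bar> \<le> 4 / (1 + \<bar>\<xi>\<bar>)\<close> for frequencies beyond
    1.\<close>
  define C where "C = 4 powr (\<beta> / 2) * (1 + W)"
  have C1: "2 powr (\<beta> / 2) \<le> C"
  proof -
    have "2 powr (\<beta> / 2) \<le> (4::real) powr (\<beta> / 2)" using \<beta> by (intro powr_mono2) auto
    also have "\<dots> \<le> C" unfolding C_def using W by simp
    finally show ?thesis .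
  qed
  have "0 < (2::real) powr (\<beta> / 2)" by simp
  then have C0: "0 < C" using C1 by linarith
  have "cmod (?F \<xi>) \<le> C * (1 + \<bar>\<xi>\<bar>) powr (- \<beta> / 2)" for \<xi>
  proof (cases "\<bar>\<xi>\<bar> \<le> 1")
    case True
    interpret real_distribution cantor_measure by (rule real_distribution_cantor_measure)
    have "cmod (?F \<xi>) = cmod (char cantor_measure (- \<xi>))"
      by (simp add: fourier_transform_def char_def mult.commute)
    also have "\<dots> \<le> 1" by (rule cmod_char_le_1)
    also have "1 = 2 powr (\<beta> / 2) * 2 powr (- \<beta> / 2)" by (simp flip: powr_add)
    also have "\<dots> \<le> C * (1 + \<bar>\<xi>\<bar>) powr (- \<beta> / 2)"
      using C1 C0 \<beta> True by (intro mult_mono powr_mono2') auto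
    finally show ?thesis .
  next
    case False
    have "(2 / \<bar>\<xi>\<bar>) powr (\<beta> / 2) \<le> (4 / (1 + \<bar>\<xi>\<bar>)) powr (\<beta> / 2)"
      using False \<beta> by (intro powr_mono2) (auto simp: field_simps)
    also have "\<dots> = 4 powr (\<beta> / 2) * (1 + \<bar>\<xi>\<bar>) powr (- \<beta> / 2)"
      by (simp add: powr_divide powr_minus_divide)
    finally have "(2 / \<bar>\<xi>\<bar>) powr (\<beta> / 2) * (1 + W) \<le> 4 powr (\<beta> / 2) * (1 + \<bar>\<xi>\<bar>) powr (- \<beta> / 2) * (1 + W)"
      using W by (intro mult_right_mono) auto
    moreover have "\<xi> \<noteq> 0" using False by auto
    ultimately show ?thesis using large[of \<xi>] by (simp add: C_def mult_ac)
  qed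
  then show ?thesis using C0 by blast
qed

end

section \<open>Choice of parameters\<close>

lemma sum_cubes_Suc: "real (\<Sum>k<n. (k + 1) ^ 3) = (real n * (real n + 1) / 2)\<^sup>2"
  by (induction n) (simp_all add: field_simps power2_eq_square power3_eq_cube)

lemma sum_cubes_Suc_Suc: "real (\<Sum>k<n. (k + 2) ^ 3) = ((real n + 1) * (real n + 2) / 2)\<^sup>2 - 1"
  by (induction n) (simp_all add: field_simps power2_eq_square power3_eq_cube)

text \<open>The exponent behaves like \<open>(\<beta> - 1) * n ^ 4 / 8\<close>, since
  \<open>l n - p n\<close> is only of order \<open>n ^ 3\<close>; this outweighs the polynomial
  factor coming from the logarithm of the net size.\<close>

lemma summable_decay:
  fixes \<beta> :: real
  assumes "\<beta> < 1"
  defines "l \<equiv> \<lambda>n. ((real n + 2) * (real n + 3) / 2)\<^sup>2 - 1"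
    and "p \<equiv> \<lambda>n. (real n * (real n + 1) / 2)\<^sup>2"
  shows "summable (\<lambda>n. (4 * (ln 32 + 2 * (l n * ln 2)) + 6) * 2 powr (\<beta> * l n / 2 - p n / 2))"
proof (rule summable_comparison_test_bigo)
  show "summable (\<lambda>n. norm (1 / real n ^ 2))"
    using inverse_power_summable[of 2, where 'a = real] by (simp add: inverse_eq_divide)
  define \<gamma> where "\<gamma> = 1 - \<beta>"
  have \<gamma>: "0 < \<gamma>" using assms by (simp add: \<gamma>_def)
  have "\<beta> * l n / 2 - p n / 2 = (l n - p n) / 2 - \<gamma> / 2 * l n" for n
    by (simp add: \<gamma>_def field_simps)
  moreover have "(\<lambda>n. (4 * (ln 32 + 2 * (l n * ln 2)) + 6) * 2 powr ((l n - p n) / 2 - \<gamma> / 2 * l n))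
      \<in> O(\<lambda>n. 1 / real n ^ 2)"
    unfolding l_def p_def using \<gamma> by real_asymp
  ultimately show "(\<lambda>n. (4 * (ln 32 + 2 * (l n * ln 2)) + 6) * 2 powr (\<beta> * l n / 2 - p n / 2))
      \<in> O(\<lambda>n. 1 / real n ^ 2)" by simp
qed

text \<open>The phases of stage \<open>n\<close> contain all earlier translates through
  \<open>T n\<close>, so the choices have to be made one stage after another.\<close>

lemma digit_tree_exists:
  fixes c M :: "nat \<Rightarrow> nat"
  assumes c: "\<And>n. 2 \<le> c n" and M: "\<And>n. 2 \<le> M n" and cM: "\<And>n. c n \<le> M n"
    and A: "\<And>n. convex_digits (n + 1) (M n) (c n) (A n)"
  shows "\<exists>a T. digit_tree c M A a T \<and> (\<forall>n \<theta>.
    norm (\<Sum>j<(\<Prod>k<n. c k). digit_tree.oscillation c M A a T n \<theta> j)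
      \<le> sqrt (\<Prod>k<n. c k) * (4 * ln (32 * (real (\<Prod>k<Suc n. M k))\<^sup>2) + 6))"
proof -
  define P where P: "P = (\<lambda>n. \<Prod>k<n. c k)"
  define L where L: "L = (\<lambda>n. \<Prod>k<n. M k)"
  define osc where "osc = (\<lambda>n (t :: nat \<Rightarrow> nat) a \<theta> j.
     (\<Sum>r<c n. cis (- (\<theta> * real (t j * M n + (A n r + a j) mod M n)))) / of_nat (c n)
     - (\<Sum>b<M n. cis (- (\<theta> * real (t j * M n + b)))) / of_nat (M n))"
  define child where "child = (\<lambda>n (t :: nat \<Rightarrow> nat) a j. t (j div c n) * M n + (A n (j mod c n) + a (j div c n)) mod M n)"
  define good where "good = (\<lambda>n t a. \<forall>\<theta>. norm (\<Sum>j<P n. osc n t a \<theta> j)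
      \<le> sqrt (P n) * (4 * ln (32 * (real (L (Suc n)))\<^sup>2) + 6))"
  have pos: "0 < c n" "0 < M n" for n
    using c[of n] M[of n] by linarith+
  have PL: "0 < P n" "0 < L n" "P n \<le> L n" for n
    using pos cM by (auto simp: P L intro!: prod_pos prod_mono)
  \<comment> \<open>The bound covers also indices beyond \<open>P n\<close>, as
    \<open>translates_choice\<close> asks for it at every index; the second clause pins the
    root.\<close>
  define Pre where "Pre = (\<lambda>n t. (\<forall>j :: nat. t j < L n) \<and> (n = 0 \<longrightarrow> t = (\<lambda>_. 0)))"
  have "\<exists>T. \<forall>n. Pre n (T n) \<and> (\<exists>a. T (Suc n) = child n (T n) a \<and> good n (T n) a)"
  proof (rule dependent_nat_choice)
    show "\<exists>t. Pre 0 t"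
      by (intro exI[of _ "\<lambda>_. 0"]) (simp add: L Pre_def)
  next
    fix t n assume "Pre n t"
    then have t: "t j < L n" for j by (simp add: Pre_def)
    obtain a where "good n t a"
      using translates_choice[of "P n" "c n" "M n" "L n" t "A n"] PL pos t
      unfolding good_def osc_def by (auto simp: L)
    moreover have "child n t a j < L (Suc n)" for j
    proof -
      have "child n t a j < Suc (t (j div c n)) * M n" using pos by (simp add: child_def)
      also have "\<dots> \<le> L n * M n" using t by (intro mult_right_mono Suc_leI) auto
      finally show ?thesis by (simp add: L)
    qed
    ultimately show "\<exists>t'. Pre (Suc n) t' \<and> (\<exists>a. t' = child n t a \<and> good n t a)"
      by (auto simp: Pre_def)
  qed
  then obtain T where "Pre 0 (T 0)"
    and step: "\<And>n. \<exists>a. T (Suc n) = child n (T n) a \<and> good n (T n) a" by blast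
  then have T0: "T 0 = (\<lambda>_. 0)" by (simp add: Pre_def)
  obtain a where a: "\<And>n. T (Suc n) = child n (T n) (a n)" "\<And>n. good n (T n) (a n)" using step by metis
  interpret digit_tree c M A a T
    by unfold_locales (auto simp: c M A T0 a(1) child_def simp del: One_nat_def)
  have "oscillation n \<theta> j = osc n (T n) (a n) \<theta> j" for n \<theta> j
    by (simp add: oscillation_def osc_def)
  then have "norm (\<Sum>j<(\<Prod>k<n. c k). oscillation n \<theta> j)
      \<le> sqrt (\<Prod>k<n. c k) * (4 * ln (32 * (real (\<Prod>k<Suc n. M k))\<^sup>2) + 6)" for n \<theta>
    using a(2)[of n] unfolding good_def P L by simp
  then show ?thesis using digit_tree_axioms by blast
qed

section \<open>From the tree to forms and to the Fourier dimension\<close>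

lemma tuple_diam_ge:
  assumes "i \<le> v" "j \<le> v" "i \<noteq> j"
  shows "\<bar>x i - x j\<bar> \<le> tuple_diam v x"
proof -
  have "{\<bar>x i - x j\<bar> | i j. i \<le> v \<and> j \<le> v \<and> i \<noteq> j} \<subseteq> (\<lambda>(i, j). \<bar>x i - x j\<bar>) ` ({..v} \<times> {..v})"
    by auto
  then have "finite {\<bar>x i - x j\<bar> | i j. i \<le> v \<and> j \<le> v \<and> i \<noteq> j}" by (rule finite_subset) simp
  then show ?thesis unfolding tuple_diam_def using assms by (intro Max_ge) auto
qed

lemma (in digit_tree) form_zeros_in_limit_set:
  assumes m: "m \<in> form_coeffs v" "\<forall>i\<le>v. m i \<le> N"
  shows "in_power limit_set v x \<and> tuple_diam v x < 1 / real (L N) \<and> lin_form v m x = 0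
    \<longrightarrow> (\<forall>i\<le>v. x i = x 0)"
proof (intro impI allI, elim conjE)
  fix i
  assume x: "in_power limit_set v x" "tuple_diam v x < 1 / real (L N)" "lin_form v m x = 0"
    and i: "i \<le> v"
  have "(\<forall>i\<le>v. 1 \<le> m i) \<and> m 0 = sum m {1..v} \<and> Gcd (m ` {0..v}) = 1"
    using m(1) unfolding form_coeffs_def by (rule CollectD)
  then have m': "\<And>i. i \<le> v \<Longrightarrow> 1 \<le> m i" "m 0 = sum m {1..v}" by blast+
  have mpos: "0 < m i" if "i \<in> {1..v}" for i
    using m'(1)[of i] that by simp
  have m0N: "m 0 \<le> N" using m(2) by blast
  have close: "\<bar>x i - x 0\<bar> < 1 / real (L N)" if "i \<le> v" for i
  proof (cases "i = 0")
    case True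
    then show ?thesis by simp
  next
    case False
    then have "\<bar>x i - x 0\<bar> \<le> tuple_diam v x" using that by (intro tuple_diam_ge) simp_all
    then show ?thesis using x(2) by (rule le_less_trans)
  qed
  have E: "x i \<in> limit_set" if "i \<le> v" for i
    using x(1) that unfolding in_power_def by blast
  show "x i = x 0"
    by (rule limit_set_zero_trivial[where x = x and v = v and m = m and N = N,
          OF E mpos m'(2) m0N x(3) close i])
qed

lemma (in digit_tree) nontrivial_zero_in_limit_set:
  assumes m: "m \<in> form_coeffs v" "\<forall>i\<le>v. m i \<le> N" and v: "2 \<le> v"
    and x: "nontrivial_zero limit_set v (lin_form v m) x"
  shows "1 / real (L N) \<le> tuple_diam v x"
proof (rule ccontr)
  assume "\<not> 1 / real (L N) \<le> tuple_diam v x"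
  then have "in_power limit_set v x \<and> tuple_diam v x < 1 / real (L N) \<and> lin_form v m x = 0"
    using x by (simp add: nontrivial_zero_def)
  then have "\<forall>i\<le>v. x i = x 0" by (rule form_zeros_in_limit_set[OF m, THEN mp])
  then have "1 \<le> v \<longrightarrow> x 1 = x 0" by (rule spec)
  then have "x 1 = x 0" using v by simp
  moreover have inj: "inj_on x {0..v}" using x by (simp add: nontrivial_zero_def)
  ultimately show False using inj_onD[OF inj, of 1 0] v by simp
qed

text \<open>The supremum is 1 even if exponent 1 itself is not attained.\<close>

lemma fourier_dim_eq_1:
  assumes \<mu>: "real_distribution \<mu>" "measure \<mu> E = 1"
    and decay: "\<And>\<beta>. 0 \<le> \<beta> \<Longrightarrow> \<beta> < 1 \<Longrightarrow>
      \<exists>C>0. \<forall>\<xi>. cmod (fourier_transform \<mu> \<xi>) \<le> C * (1 + \<bar>\<xi>\<bar>) powr (- \<beta> / 2)"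
  shows "fourier_dim E = 1"
proof (rule antisym)
  show "fourier_dim E \<le> 1" unfolding fourier_dim_def by (rule Sup_least) auto
  show "1 \<le> fourier_dim E"
  proof (rule dense_le)
    fix y :: ereal assume y: "y < 1"
    \<comment> \<open>\<open>decay\<close> speaks of nonnegative exponents only, so smaller
      \<open>y\<close>, including minus infinity, are replaced by 0.\<close>
    define b where "b = max 0 (real_of_ereal y)"
    have b: "0 \<le> b" by (simp add: b_def)
    have b1: "b < 1" using y by (cases y) (simp_all add: b_def)
    have yb: "y \<le> ereal b" using y by (cases y) (simp_all add: b_def)
    have "ereal b \<le> fourier_dim E"
      unfolding fourier_dim_def
    proof (intro Sup_upper imageI CollectI conjI exI[of _ \<mu>])
      show "b \<le> 1" using b1 by simp
    qed (fact \<mu> decay[OF b b1])+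
    then show "y \<le> fourier_dim E" using yb by (rule order_trans[rotated])
  qed
qed

theorem theorem1p6:
  shows "\<exists>E :: real set. E \<subseteq> {0..1} \<and> E \<in> sets borel \<and> fourier_dim E = 1 \<and>
    (\<forall>v\<ge>2. \<forall>f\<in>forms v. \<exists>\<kappa>>0.
       (\<forall>x. in_power E v x \<and> tuple_diam v x < \<kappa> \<and> f x = 0 \<longrightarrow> (\<forall>i\<le>v. x i = x 0)) \<and>
       (\<forall>x. nontrivial_zero E v f x \<longrightarrow> \<kappa> \<le> tuple_diam v x)) \<and>
    (\<forall>N::nat. \<exists>\<kappa>>0. \<forall>v\<ge>2. \<forall>m\<in>form_coeffs v. (\<forall>i\<le>v. m i \<le> N) \<longrightarrow>
       (\<forall>x. in_power E v x \<and> tuple_diam v x < \<kappa> \<and> lin_form v m x = 0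
          \<longrightarrow> (\<forall>i\<le>v. x i = x 0)) \<and>
       (\<forall>x. nontrivial_zero E v (lin_form v m) x \<longrightarrow> \<kappa> \<le> tuple_diam v x))"
proof -
  \<comment> \<open>The case \<open>k = n + 1\<close> of \<open>convex_digits_exist\<close>. Here
    \<open>M n = c (Suc n)\<close>, which keeps the logarithms of \<open>L n\<close> and
    \<open>P n\<close> close.\<close>
  define c M :: "nat \<Rightarrow> nat" where "c = (\<lambda>n. 2 ^ ((n + 1) ^ 3))" and "M = (\<lambda>n. 2 ^ ((n + 2) ^ 3))"
  have "\<exists>A. convex_digits (n + 1) (M n) (c n) A" for n
    using convex_digits_exist[of n] by (simp add: c_def M_def)
  then obtain A where A: "\<And>n. convex_digits (n + 1) (M n) (c n) (A n)" by metis
  have two: "2 \<le> (2::nat) ^ k" if "0 < k" for k using that self_le_power[of 2 k] by simp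
  have "\<exists>a T. digit_tree c M A a T \<and> (\<forall>n \<theta>.
    norm (\<Sum>j<(\<Prod>k<n. c k). digit_tree.oscillation c M A a T n \<theta> j)
      \<le> sqrt (\<Prod>k<n. c k) * (4 * ln (32 * (real (\<Prod>k<Suc n. M k))\<^sup>2) + 6))"
  proof (intro digit_tree_exists A)
    show "2 \<le> c n" "2 \<le> M n" "c n \<le> M n" for n
      unfolding c_def M_def by (intro two power_increasing power_mono zero_less_power; simp)+
  qed
  then obtain a T where tree: "digit_tree c M A a T"
    and osc0: "\<And>n \<theta>. norm (\<Sum>j<(\<Prod>k<n. c k). digit_tree.oscillation c M A a T n \<theta> j)
      \<le> sqrt (\<Prod>k<n. c k) * (4 * ln (32 * (real (\<Prod>k<Suc n. M k))\<^sup>2) + 6)" by blast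
  interpret digit_tree c M A a T by (rule tree)
  define l where "l = (\<lambda>n. ((real n + 2) * (real n + 3) / 2)\<^sup>2 - 1)"
  define p where "p = (\<lambda>n. (real n * (real n + 1) / 2)\<^sup>2)"
  have L: "real (L (Suc n)) = 2 powr l n" for n
  proof -
    have e: "real (Suc n) + 1 = real n + 2" "real (Suc n) + 2 = real n + 3" by simp_all
    have "L (Suc n) = 2 ^ (\<Sum>k<Suc n. (k + 2) ^ 3)"
      unfolding L_def unfolding M_def by (rule power_sum[symmetric])
    then have "real (L (Suc n)) = 2 powr real (\<Sum>k<Suc n. (k + 2) ^ 3)"
      by (simp only: of_nat_power of_nat_numeral powr_realpow zero_less_numeral)
    then show ?thesis by (simp only: sum_cubes_Suc_Suc l_def e)
  qed
  have P: "real (P n) = 2 powr p n" for n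
  proof -
    have "P n = 2 ^ (\<Sum>k<n. (k + 1) ^ 3)"
      unfolding P_def unfolding c_def by (rule power_sum[symmetric])
    then have "real (P n) = 2 powr real (\<Sum>k<n. (k + 1) ^ 3)"
      by (simp only: of_nat_power of_nat_numeral powr_realpow zero_less_numeral)
    then show ?thesis by (simp only: sum_cubes_Suc p_def)
  qed
  \<comment> \<open>\<open>2 powr (- p n / 2)\<close> is \<open>1 / sqrt (P n)\<close>, the square
    root saving; the first factor is the logarithmic cost of the net.\<close>
  define \<eta> where "\<eta> = (\<lambda>n. (4 * (ln 32 + 2 * (l n * ln 2)) + 6) * 2 powr (- p n / 2))"
  have osc: "norm (\<Sum>j<P n. oscillation n \<theta> j) \<le> real (P n) * \<eta> n" for n \<theta>
  proof -
    have "ln (32 * (real (L (Suc n)))\<^sup>2) = ln 32 + 2 * (l n * ln 2)"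
      by (simp add: L ln_mult ln_realpow ln_powr)
    moreover have "sqrt (P n) = real (P n) * 2 powr (- p n / 2)"
      by (simp add: P powr_half_sqrt[symmetric] powr_powr flip: powr_add)
    moreover have "norm (\<Sum>j<P n. oscillation n \<theta> j)
        \<le> sqrt (P n) * (4 * ln (32 * (real (L (Suc n)))\<^sup>2) + 6)"
      using osc0[of n \<theta>] unfolding P_def L_def .
    ultimately show ?thesis by (simp add: \<eta>_def mult_ac)
  qed
  have decay: "\<exists>C>0. \<forall>\<xi>. cmod (fourier_transform cantor_measure \<xi>) \<le> C * (1 + \<bar>\<xi>\<bar>) powr (- \<beta> / 2)"
    if "0 \<le> \<beta>" "\<beta> < 1" for \<beta>
  proof (rule fourier_decay[OF osc])
    have "\<eta> n * real (L (Suc n)) powr (\<beta> / 2)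
        = (4 * (ln 32 + 2 * (l n * ln 2)) + 6) * 2 powr (\<beta> * l n / 2 - p n / 2)" for n
      unfolding \<eta>_def L powr_powr mult.assoc by (simp add: algebra_simps flip: powr_add)
    then show "summable (\<lambda>n. \<eta> n * real (L (Suc n)) powr (\<beta> / 2))"
      using summable_decay[of \<beta>] that(2) by (simp add: l_def p_def)
  qed (use that in auto)
  define avoids where "avoids = (\<lambda>\<kappa> v f.
       (\<forall>x. in_power limit_set v x \<and> tuple_diam v x < \<kappa> \<and> f x = 0 \<longrightarrow> (\<forall>i\<le>v. x i = x 0)) \<and>
       (\<forall>x. nontrivial_zero limit_set v f x \<longrightarrow> \<kappa> \<le> tuple_diam v x))"
  have avoids: "avoids (1 / real (L N)) v (lin_form v m)"
    if v: "2 \<le> v" and m: "m \<in> form_coeffs v" "\<forall>i\<le>v. m i \<le> N" for N v m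
    unfolding avoids_def
  proof (rule conjI; rule allI)
    show "in_power limit_set v x \<and> tuple_diam v x < 1 / real (L N) \<and> lin_form v m x = 0
        \<longrightarrow> (\<forall>i\<le>v. x i = x 0)" for x
      using m by (rule form_zeros_in_limit_set)
    show "nontrivial_zero limit_set v (lin_form v m) x \<longrightarrow> 1 / real (L N) \<le> tuple_diam v x" for x
      using nontrivial_zero_in_limit_set[OF m v] by (rule impI)
  qed
  have \<kappa>: "0 < 1 / real (L N)" for N by simp
  have single: "\<exists>\<kappa>>0. avoids \<kappa> v f" if v: "2 \<le> v" and f: "f \<in> forms v" for v f
  proof -
    obtain m where m: "m \<in> form_coeffs v" "f = lin_form v m" using f unfolding forms_def by (rule imageE)
    \<comment> \<open>For a single form the largest coefficient serves as \<open>N\<close>.\<close>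
    have "\<forall>i\<le>v. m i \<le> Max (m ` {..v})" by simp
    then show ?thesis unfolding m(2) using avoids[OF v m(1)] \<kappa> by blast
  qed
  \<comment> \<open>The threshold \<open>1 / L N\<close> depends on neither \<open>v\<close> nor
    \<open>m\<close>.\<close>
  have uniform: "\<exists>\<kappa>>0. \<forall>v\<ge>2. \<forall>m\<in>form_coeffs v. (\<forall>i\<le>v. m i \<le> N) \<longrightarrow> avoids \<kappa> v (lin_form v m)" for N
    using avoids \<kappa> by blast
  have "fourier_dim limit_set = 1"
    using real_distribution_cantor_measure measure_limit_set decay by (rule fourier_dim_eq_1)
  moreover have "limit_set \<in> sets borel" using closed_limit_set by simp
  ultimately show ?thesis
    using limit_set_subset single uniform unfolding avoids_def
    by (intro exI[of _ limit_set] conjI allI impI ballI)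
qed

end
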